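(* Let $S$ be an affine semigroup minimally generated by $\mathcal{A}=\{\mathbf{a}_1,\ldots,\mathbf{a}_p\}\subset\mathbb{N}^r$, and let $\mathbf{d}\in S$ be nonzero. The following are equivalent: (a) $\mathrm{Betti}(S)=\{\mathbf{d}\}$. (b) $\mathcal{C}_\mathcal{A}=\big(\mathsf{Z}(\mathbf{d})\times\mathsf{Z}(\mathbf{d})\big)\setminus\{(\mathbf{u},\mathbf{u})\mid \pi_\mathcal{A}(\mathbf{u})=\mathbf{d}\}=\mathrm{Gr}_\mathcal{A}$. (c) $S$ is the gluing of some $S_1$ and $S_2$ by $\mathbf{d}$, with $\mathrm{Betti}(S_1)\cup\mathrm{Betti}(S_2)\subseteq\{\mathbf{d}\}$.
   Context: $\mathbb{N}$ denotes the nonnegative integers and $\mathbb{Z}$ the integers. An affine semigroup is a finitely generated submonoid of $\mathbb{N}^r$ for some positive integer $r$. $S$ is minimally generated by $\mathcal{A}$ (a set of $p$ distinct elements) if $S=\mathbb{N}\mathbf{a}_1+\cdots+\mathbb{N}\mathbf{a}_p$ and no proper subset of $\mathcal{A}$ generates $S$. The factorization homomorphism is $\pi_\mathcal{A}:\mathbb{N}^p\to S$, $\mathbf{u}=(u_1,\ldots,u_p)\mapsto\sum_{i=1}^p u_i\mathbf{a}_i$; for $\mathbf{a}\in S$, $\mathsf{Z}(\mathbf{a})=\pi_\mathcal{A}^{-1}(\mathbf{a})$ is its set of factorizations. The kernel congruence $\equiv_\mathcal{A}$ is the set of pairs $(\mathbf{u},\mathbf{v})\in\mathbb{N}^p\times\mathbb{N}^p$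 with $\pi_\mathcal{A}(\mathbf{u})=\pi_\mathcal{A}(\mathbf{v})$. A presentation of $S$ is a set $\sigma\subseteq\mathbb{N}^p\times\mathbb{N}^p$ such that $\equiv_\mathcal{A}$ is the least congruence on $\mathbb{N}^p$ containing $\sigma$; it is minimal if no proper subset of it generates $\equiv_\mathcal{A}$ as a congruence. $\mathrm{Betti}(S)=\{\pi_\mathcal{A}(\mathbf{u})\mid(\mathbf{u},\mathbf{v})\in\sigma\}$ for a minimal presentation $\sigma$ of $S$; this set is known not to depend on the choice of $\sigma$. The same definition applies to any affine semigroup with respect to its minimal generating set. $\mathrm{Betti}(S)=\varnothing$ if and only if $S$ is free, i.e. isomorphic as a monoid to $\mathbb{N}^s$ for some $s$. The support of $\mathbf{u}\in\mathbb{N}^p$ is $\mathrm{supp}(\mathbf{u})=\{i\mid u_i\neq 0\}$. Graver basis: let $\mathcal{I}(\mathcal{A})$ be the set of minimal elements of $\equiv_\mathcal{A}\setminus\{(0,0)\}$ with respect to the usual componentwise partial order on $\mathbb{N}^p\times\mathbb{N}^p$. Then $\mathrm{Gr}_\mathcal{A}=\mathcal{I}(\mathcal{A})\setminus\{(\mathbf{e}_1,\mathbf{e}_1),\ldots,(\mathbf{e}_p,\mathbf{e}_p)\}$, where $\mathbf{e}_i$ are the standard unit vectors of $\mathbb{N}^p$. Circuits: $\mathcal{C}_\mathcal{A}$ is the set of nonzero $(\mathbf{u},\mathbf{v})\in{\equiv_\mathcal{A}}$ such that $\mathbf{u}$ and $\mathbf{v}$ have disjoint supports, $\mathrm{supp}(\mathbf{u})\cup\mathrm{supp}(\mathbf{v})$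 is minimal with respect to inclusion (among all such unions for nonzero pairs of $\equiv_\mathcal{A}$ with disjoint supports), and the coordinates of $(\mathbf{u},\mathbf{v})$ are relatively prime (their overall gcd is $1$). Gluing: $S$ is the gluing of $S_1$ and $S_2$ by $\mathbf{d}$ if there are disjoint nontrivial (nonempty) subsets $\mathcal{A}_1,\mathcal{A}_2$ of $\mathcal{A}$ with $\mathcal{A}=\mathcal{A}_1\cup\mathcal{A}_2$, $S_1$ and $S_2$ are the affine semigroups generated by $\mathcal{A}_1$ and $\mathcal{A}_2$ respectively, $\mathbf{d}\in (S_1\cap S_2)\setminus\{0\}$, and $\mathbb{Z}\mathcal{A}_1\cap\mathbb{Z}\mathcal{A}_2=\mathbb{Z}\mathbf{d}$, where $\mathbb{Z}\mathcal{B}$ denotes the subgroup of $\mathbb{Z}^r$ generated by $\mathcal{B}$.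
   Formalization: The implication from (b) to (a) is stated only for S not free: if S is free, all three sets in (b) are empty, so (b) holds, while Betti(S) is empty and (a) fails. The equivalence of (a) and (c), and (a) implies (b), are stated for all S. *)

theory Defs
  imports
    "HOL-Analysis.Finite_Cartesian_Product"
    "HOL-Library.Function_Algebras"
    "HOL-Library.Product_Order"
    "HOL-Computational_Algebra.Group_Closure"
begin

text \<open>
  Factorizations are indexed by the generators themselves: for a finite set \<open>A\<close> of \<open>p\<close> vectors,
  the monoid of \<open>p\<close>-tuples of naturals is the set of functions into \<^typ>\<open>nat\<close> that vanish
  outside \<open>A\<close>. The sum and the order on such functions are pointwise, and the order on pairs is
  componentwise. The ambient dimension is the size of the (nonempty) finite index type \<open>'r\<close>.
\<close>

definition exponents :: "'v set \<Rightarrow> ('v \<Rightarrow> nat) set" where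
  "exponents A = {u. \<forall>a. a \<notin> A \<longrightarrow> u a = 0}"

definition supp :: "('v \<Rightarrow> nat) \<Rightarrow> 'v set" where
  "supp u = {a. u a \<noteq> 0}"

definition factorization_hom :: "(nat ^ 'r) set \<Rightarrow> (nat ^ 'r \<Rightarrow> nat) \<Rightarrow> nat ^ 'r" where
  "factorization_hom A u = (\<Sum>a\<in>A. u a *s a)"

definition monoid_generated :: "(nat ^ 'r) set \<Rightarrow> (nat ^ 'r) set" where
  "monoid_generated A = factorization_hom A ` exponents A"

definition affine_semigroup :: "(nat ^ 'r) set \<Rightarrow> bool" where
  "affine_semigroup S \<longleftrightarrow> (\<exists>A. finite A \<and> S = monoid_generated A)"

definition minimally_generated_by :: "(nat ^ 'r) set \<Rightarrow> (nat ^ 'r) set \<Rightarrow> bool" where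
  "minimally_generated_by S A \<longleftrightarrow>
     finite A \<and> S = monoid_generated A \<and> (\<forall>B. B \<subset> A \<longrightarrow> monoid_generated B \<noteq> S)"

definition factorizations :: "(nat ^ 'r) set \<Rightarrow> nat ^ 'r \<Rightarrow> (nat ^ 'r \<Rightarrow> nat) set" where
  "factorizations A b = {u \<in> exponents A. factorization_hom A u = b}"

definition kernel_congruence ::
    "(nat ^ 'r) set \<Rightarrow> ((nat ^ 'r \<Rightarrow> nat) \<times> (nat ^ 'r \<Rightarrow> nat)) set" where
  "kernel_congruence A =
     {(u, v). u \<in> exponents A \<and> v \<in> exponents A \<and> factorization_hom A u = factorization_hom A v}"

definition congruence_on :: "'v set \<Rightarrow> (('v \<Rightarrow> nat) \<times> ('v \<Rightarrow> nat)) set \<Rightarrow> bool" where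
  "congruence_on A R \<longleftrightarrow>
     equiv (exponents A) R \<and> (\<forall>(u, v)\<in>R. \<forall>w\<in>exponents A. (u + w, v + w) \<in> R)"

definition congruence_generated ::
    "'v set \<Rightarrow> (('v \<Rightarrow> nat) \<times> ('v \<Rightarrow> nat)) set \<Rightarrow> (('v \<Rightarrow> nat) \<times> ('v \<Rightarrow> nat)) set" where
  "congruence_generated A \<sigma> = \<Inter>{R. congruence_on A R \<and> \<sigma> \<subseteq> R}"

definition presentation ::
    "(nat ^ 'r) set \<Rightarrow> ((nat ^ 'r \<Rightarrow> nat) \<times> (nat ^ 'r \<Rightarrow> nat)) set \<Rightarrow> bool" where
  "presentation A \<sigma> \<longleftrightarrow>
     \<sigma> \<subseteq> exponents A \<times> exponents A \<and> congruence_generated A \<sigma> = kernel_congruence A"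

definition minimal_presentation ::
    "(nat ^ 'r) set \<Rightarrow> ((nat ^ 'r \<Rightarrow> nat) \<times> (nat ^ 'r \<Rightarrow> nat)) set \<Rightarrow> bool" where
  "minimal_presentation A \<sigma> \<longleftrightarrow>
     presentation A \<sigma> \<and> (\<forall>\<tau>. \<tau> \<subset> \<sigma> \<longrightarrow> \<not> presentation A \<tau>)"

text \<open>
  The minimal generating set of an affine semigroup is unique, minimal presentations exist, and
  the set of values below is the same for each of them, so the quantification over \<open>A\<close> and
  \<open>\<sigma>\<close> only serves to avoid an arbitrary choice.
\<close>

definition Betti :: "(nat ^ 'r) set \<Rightarrow> (nat ^ 'r) set" where
  "Betti S = {factorization_hom A u | A \<sigma> u v.
     minimally_generated_by S A \<and> minimal_presentation A \<sigma> \<and> (u, v) \<in> \<sigma>}"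

text \<open>
  If \<open>S\<close> is free, then the circuits, the Graver basis and the pairs of distinct factorizations of
  any \<open>d\<close> are all empty sets, hence equal, while the set of Betti elements is empty too. Free
  semigroups therefore have to be excluded when a Betti element is to be derived from the equality
  of these three sets.
\<close>

definition free_semigroup :: "(nat ^ 'r) set \<Rightarrow> bool" where
  "free_semigroup S \<longleftrightarrow>
     (\<exists>s (f :: (nat \<Rightarrow> nat) \<Rightarrow> nat ^ 'r). bij_betw f (exponents {..<s}) S \<and> f 0 = 0 \<and>
        (\<forall>u\<in>exponents {..<s}. \<forall>v\<in>exponents {..<s}. f (u + v) = f u + f v))"

definition minimal_kernel_pairs ::
    "(nat ^ 'r) set \<Rightarrow> ((nat ^ 'r \<Rightarrow> nat) \<times> (nat ^ 'r \<Rightarrow> nat)) set" where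
  "minimal_kernel_pairs A =
     {x \<in> kernel_congruence A - {(0, 0)}. \<forall>y \<in> kernel_congruence A - {(0, 0)}. y \<le> x \<longrightarrow> y = x}"

definition unit_exponent :: "'v \<Rightarrow> 'v \<Rightarrow> nat" where
  "unit_exponent a = (\<lambda>x. if x = a then 1 else 0)"

definition Graver_basis ::
    "(nat ^ 'r) set \<Rightarrow> ((nat ^ 'r \<Rightarrow> nat) \<times> (nat ^ 'r \<Rightarrow> nat)) set" where
  "Graver_basis A = minimal_kernel_pairs A - {(unit_exponent a, unit_exponent a) | a. a \<in> A}"

definition disjoint_kernel_pairs ::
    "(nat ^ 'r) set \<Rightarrow> ((nat ^ 'r \<Rightarrow> nat) \<times> (nat ^ 'r \<Rightarrow> nat)) set" where
  "disjoint_kernel_pairs A =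
     {(u, v) \<in> kernel_congruence A. (u, v) \<noteq> (0, 0) \<and> supp u \<inter> supp v = {}}"

definition circuits ::
    "(nat ^ 'r) set \<Rightarrow> ((nat ^ 'r \<Rightarrow> nat) \<times> (nat ^ 'r \<Rightarrow> nat)) set" where
  "circuits A =
     {(u, v) \<in> disjoint_kernel_pairs A.
        (\<forall>(u', v') \<in> disjoint_kernel_pairs A. \<not> supp u' \<union> supp v' \<subset> supp u \<union> supp v) \<and>
        Gcd (u ` A \<union> v ` A) = 1}"

definition int_vec :: "nat ^ 'r \<Rightarrow> int ^ 'r" where
  "int_vec x = (\<chi> i. int (x $ i))"

definition subgroup_generated :: "(nat ^ 'r) set \<Rightarrow> (int ^ 'r) set" where
  "subgroup_generated B = group_closure (int_vec ` B)"

text \<open>Gluing of the semigroup minimally generated by \<open>A\<close>.\<close>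

definition is_gluing ::
    "(nat ^ 'r) set \<Rightarrow> (nat ^ 'r) set \<Rightarrow> (nat ^ 'r) set \<Rightarrow> nat ^ 'r \<Rightarrow> bool" where
  "is_gluing A S1 S2 d \<longleftrightarrow>
     (\<exists>A1 A2. A1 \<noteq> {} \<and> A2 \<noteq> {} \<and> A1 \<inter> A2 = {} \<and> A = A1 \<union> A2 \<and>
        S1 = monoid_generated A1 \<and> S2 = monoid_generated A2 \<and>
        d \<in> (S1 \<inter> S2) - {0} \<and>
        subgroup_generated A1 \<inter> subgroup_generated A2 = subgroup_generated {d})"

end

theory Submission
  imports Defs
begin

text \<open>
  The Betti elements of a semigroup are the elements whose set of factorizations is disconnected
  when factorizations with a common generator are linked. If \<open>d\<close> is the only such element, then
  elements smaller than \<open>d\<close> factor uniquely, distinct factorizations of \<open>d\<close> have disjoint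
  supports, and any two distinct factorizations of the same element lie above factorizations of
  \<open>d\<close>; this determines the Graver basis and the circuits. The support of one factorization of
  \<open>d\<close> splits the generators into a gluing, because "the difference of the parts in the first
  half is a multiple of \<open>d\<close>" defines a congruence that contains the presentation. Conversely, in
  a gluing, two factorizations of an element other than \<open>d\<close> are joined by changing the first
  half, exchanging multiples of a factorization of \<open>d\<close> from one half for the other, and changing
  the second half.
\<close>

text \<open>\<open>Betti\<close> ranges over all minimal generating sets and all minimal
  presentations, so the passage to disconnected fibres needs three facts: the generating set is
  unique, a minimal presentation exists, and its pairs lie over exactly the disconnected fibres. The
  last fact rests on a duality. Translation by a nonzero vector links the two sides of a relation,
  so relations of other values never join components; conversely, a link has a common generator that
  can be cancelled, so it follows from a relation of smaller value. Cancellation strictly lowers the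
  coordinate sum because \<open>0 \<notin> A\<close>. The group condition of a gluing is tied to
  factorizations by moving negative parts across: an element of both groups is a kernel pair in
  disguise.\<close>

section \<open>Sizes, exponents, supports and the factorization homomorphism\<close>

text \<open>The measure for inductions on semigroup elements: it is additive and vanishes only at
  \<open>0\<close>, so splitting off a nonzero summand decreases it.\<close>

definition vec_size :: "nat ^ 'r \<Rightarrow> nat" where
  "vec_size x = (\<Sum>i\<in>UNIV. x $ i)"

lemma vec_size_add [simp]: "vec_size (x + y) = vec_size x + vec_size y"
  by (simp add: vec_size_def sum.distrib)

lemma vec_size_eq_0 [simp]: "vec_size x = 0 \<longleftrightarrow> x = 0"
  by (simp add: vec_size_def vec_eq_iff)

lemma vec_size_pos [simp]: "0 < vec_size x \<longleftrightarrow> x \<noteq> 0"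
  by (simp flip: neq0_conv)

lemma vec_size_smult [simp]: "vec_size (k *s x) = k * vec_size x"
  by (simp add: vec_size_def sum_distrib_left)

lemma zero_in_exponents [simp]: "0 \<in> exponents A"
  by (simp add: exponents_def)

lemma add_in_exponents_iff [simp]:
  "u + v \<in> exponents A \<longleftrightarrow> u \<in> exponents A \<and> v \<in> exponents A"
  by (auto simp: exponents_def)

lemma exponents_downward: "u \<le> v \<Longrightarrow> v \<in> exponents A \<Longrightarrow> u \<in> exponents A"
  by (auto simp: exponents_def le_fun_def) (metis le_zero_eq)

lemma unit_in_exponents [simp]: "unit_exponent a \<in> exponents A \<longleftrightarrow> a \<in> A"
  by (auto simp: exponents_def unit_exponent_def)

lemma exponents_mono: "B \<subseteq> A \<Longrightarrow> exponents B \<subseteq> exponents A"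
  by (auto simp: exponents_def)

lemma exponents_iff_supp: "u \<in> exponents A \<longleftrightarrow> supp u \<subseteq> A"
  by (auto simp: exponents_def supp_def)

lemma supp_eq_empty [simp]: "supp u = {} \<longleftrightarrow> u = 0"
  by (auto simp: supp_def fun_eq_iff)

lemma supp_add [simp]: "supp (u + v) = supp u \<union> supp v"
  by (auto simp: supp_def)

lemma supp_mono: "u \<le> v \<Longrightarrow> supp u \<subseteq> supp v"
  by (auto simp: supp_def le_fun_def) (metis gr_zeroI leD)

lemma unit_le_iff: "unit_exponent a \<le> u \<longleftrightarrow> a \<in> supp u"
  by (auto simp: unit_exponent_def le_fun_def supp_def)

lemma unit_neq_0 [simp]: "unit_exponent a \<noteq> 0"
  by (auto simp: unit_exponent_def fun_eq_iff)

lemma nat_fun_le_obtain: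
  fixes u v :: "'v \<Rightarrow> nat"
  assumes "u \<le> v"
  obtains w where "v = u + w"
proof
  show "v = u + (v - u)"
    using assms by (auto simp: fun_eq_iff le_fun_def)
qed

lemma supp_obtain:
  assumes "a \<in> supp u"
  obtains w where "u = unit_exponent a + w"
  using assms nat_fun_le_obtain unfolding unit_le_iff[symmetric] by blast

lemma nat_fun_le_add [simp]: "u \<le> u + (w :: 'v \<Rightarrow> nat)" "u \<le> w + u"
  by (auto simp: le_fun_def)

lemma factorization_hom_0 [simp]: "factorization_hom A 0 = 0"
  by (simp add: factorization_hom_def vec_eq_iff)

lemma factorization_hom_add [simp]:
  "factorization_hom A (u + v) = factorization_hom A u + factorization_hom A v"
  by (simp add: factorization_hom_def vec_eq_iff sum.distrib algebra_simps)

lemma factorization_hom_scale: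
  "factorization_hom A (\<lambda>a. k * u a) = k *s factorization_hom A u"
  by (simp add: factorization_hom_def vec_eq_iff sum_distrib_left algebra_simps)

lemma factorization_hom_unit:
  "finite A \<Longrightarrow> a \<in> A \<Longrightarrow> factorization_hom A (unit_exponent a) = a"
proof -
  assume *: "finite A" "a \<in> A"
  have "(\<Sum>x\<in>A. unit_exponent a x *s x) = (\<Sum>x\<in>A. if x = a then x else 0)"
    by (rule sum.cong) (auto simp: unit_exponent_def vec_eq_iff)
  then show ?thesis
    using * by (simp add: factorization_hom_def)
qed

lemma factorization_hom_subset:
  "finite A \<Longrightarrow> B \<subseteq> A \<Longrightarrow> u \<in> exponents B \<Longrightarrow> factorization_hom A u = factorization_hom B u"
  unfolding factorization_hom_def
  by (rule sum.mono_neutral_right) (auto simp: exponents_def vec_eq_iff)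

text \<open>Entries are nonnegative, so nothing cancels: a coordinate where the generator
  \<open>a\<close> is nonzero forces \<open>u a = 0\<close>.\<close>

lemma factorization_hom_eq_0:
  assumes "finite A" "0 \<notin> A" "u \<in> exponents A"
  shows "factorization_hom A u = 0 \<longleftrightarrow> u = 0"
proof
  assume *: "factorization_hom A u = 0"
  have "u a = 0" for a
  proof (cases "a \<in> A")
    case True
    then have "a \<noteq> 0"
      using assms(2) by blast
    then obtain i where i: "a $ i \<noteq> 0"
      by (auto simp: vec_eq_iff)
    have "(\<Sum>a\<in>A. u a * a $ i) = 0"
      using * by (simp add: factorization_hom_def vec_eq_iff)
    then show ?thesis
      using True i assms(1) by fastforce
  qed (use assms(3) in \<open>auto simp: exponents_def\<close>)
  then show "u = 0"
    by auto
qed simp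

lemma in_monoid_generated_iff: "b \<in> monoid_generated A \<longleftrightarrow> factorizations A b \<noteq> {}"
  by (auto simp: monoid_generated_def factorizations_def)

lemma factorizations_iff:
  "u \<in> factorizations A b \<longleftrightarrow> u \<in> exponents A \<and> factorization_hom A u = b"
  by (simp add: factorizations_def)

lemma kernel_iff:
  "(u, v) \<in> kernel_congruence A \<longleftrightarrow>
     u \<in> exponents A \<and> v \<in> exponents A \<and> factorization_hom A u = factorization_hom A v"
  by (simp add: kernel_congruence_def)

lemma factorizations_subset:
  "finite A \<Longrightarrow> B \<subseteq> A \<Longrightarrow> factorizations B b \<subseteq> factorizations A b"
  using exponents_mono[of B A] factorization_hom_subset[of A B] by (auto simp: factorizations_def)

lemma factorizations_restrict:
  assumes "finite A" "B \<subseteq> A" "u \<in> factorizations A b" "u \<in> exponents B"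
  shows "u \<in> factorizations B b"
  using assms factorization_hom_subset[OF assms(1,2)] by (auto simp: factorizations_def)

section \<open>Minimal generating sets\<close>

lemma monoid_generated_mono:
  assumes "finite A" "B \<subseteq> A"
  shows "monoid_generated B \<subseteq> monoid_generated A"
  using factorizations_subset[OF assms] by (fastforce simp: in_monoid_generated_iff)

lemma monoid_generated_zero [simp]: "0 \<in> monoid_generated A"
  unfolding monoid_generated_def by (rule image_eqI[of _ _ 0]) auto

lemma monoid_generated_add:
  "x \<in> monoid_generated A \<Longrightarrow> y \<in> monoid_generated A \<Longrightarrow> x + y \<in> monoid_generated A"
  unfolding monoid_generated_def image_iff
  by (metis factorization_hom_add add_in_exponents_iff)

lemma monoid_generated_smult: "x \<in> monoid_generated A \<Longrightarrow> k *s x \<in> monoid_generated A"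
proof (induction k)
  case 0
  have "0 *s x = 0"
    by (simp add: vec_eq_iff)
  then show ?case
    by simp
next
  case (Suc k)
  have "Suc k *s x = x + k *s x"
    by (simp add: vec_eq_iff)
  then show ?case
    using Suc by (simp add: monoid_generated_add)
qed

lemma monoid_generated_sum:
  "finite I \<Longrightarrow> (\<And>i. i \<in> I \<Longrightarrow> f i \<in> monoid_generated A) \<Longrightarrow> sum f I \<in> monoid_generated A"
  by (induction I rule: finite_induct) (auto simp: monoid_generated_add)

lemma monoid_generated_base: "finite A \<Longrightarrow> a \<in> A \<Longrightarrow> a \<in> monoid_generated A"
  unfolding monoid_generated_def
  by (rule image_eqI[of _ _ "unit_exponent a"]) (auto simp: factorization_hom_unit)

lemma monoid_generated_least:
  assumes "finite A" "A \<subseteq> monoid_generated B"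
  shows "monoid_generated A \<subseteq> monoid_generated B"
proof
  fix x
  assume "x \<in> monoid_generated A"
  then obtain u where "x = (\<Sum>a\<in>A. u a *s a)"
    by (auto simp: monoid_generated_def factorization_hom_def)
  then show "x \<in> monoid_generated B"
    using assms by (auto intro!: monoid_generated_sum monoid_generated_smult)
qed

text \<open>A proper subset misses some \<open>a\<close>, and if the others yield \<open>a\<close>
  they yield all of \<open>A\<close>; so only the removal of single generators has to be tested.
  This form passes to subsets of \<open>A\<close>.\<close>

lemma minimally_generated_by_iff:
  "minimally_generated_by S A \<longleftrightarrow>
     finite A \<and> S = monoid_generated A \<and> (\<forall>a\<in>A. a \<notin> monoid_generated (A - {a}))"
proof (cases "finite A \<and> S = monoid_generated A")
  case True
  then have fin: "finite A" and S: "S = monoid_generated A"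
    by auto
  have "(\<forall>B. B \<subset> A \<longrightarrow> monoid_generated B \<noteq> S) \<longleftrightarrow> (\<forall>a\<in>A. a \<notin> monoid_generated (A - {a}))"
    (is "?L \<longleftrightarrow> ?R")
  proof
    assume L: ?L
    show ?R
    proof (intro ballI notI)
      fix a
      assume a: "a \<in> A" "a \<in> monoid_generated (A - {a})"
      have "A \<subseteq> monoid_generated (A - {a})"
      proof
        fix b
        assume "b \<in> A"
        then show "b \<in> monoid_generated (A - {a})"
          using a fin by (cases "b = a") (auto intro: monoid_generated_base)
      qed
      then have "monoid_generated (A - {a}) = S"
        unfolding S using fin
        by (intro antisym monoid_generated_least monoid_generated_mono) auto
      moreover have "A - {a} \<subset> A"
        using a by auto
      ultimately show False
        using L by blast
    qed
  next
    assume R: ?R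
    show ?L
    proof (intro allI impI notI)
      fix B
      assume B: "B \<subset> A" "monoid_generated B = S"
      then obtain a where a: "a \<in> A" "B \<subseteq> A - {a}"
        by auto
      have "a \<in> monoid_generated B"
        using B S a fin by (auto intro: monoid_generated_base)
      also have "\<dots> \<subseteq> monoid_generated (A - {a})"
        using a fin by (intro monoid_generated_mono) auto
      finally show False
        using R a by auto
    qed
  qed
  then show ?thesis
    using True by (simp add: minimally_generated_by_def)
qed (auto simp: minimally_generated_by_def)

lemma minimally_generated_by_zero_notin:
  assumes "minimally_generated_by S A"
  shows "0 \<notin> A"
  using assms monoid_generated_zero unfolding minimally_generated_by_iff by blast

text \<open>Allows the Betti elements of the two halves of a gluing to be computed over the halves
  of \<open>A\<close> themselves.\<close>

lemma minimally_generated_by_subset: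
  assumes "minimally_generated_by S A" "B \<subseteq> A"
  shows "minimally_generated_by (monoid_generated B) B"
  unfolding minimally_generated_by_iff
proof (intro conjI ballI notI refl)
  show "finite B"
    using assms by (auto simp: minimally_generated_by_iff intro: finite_subset)
next
  fix b
  assume b: "b \<in> B" "b \<in> monoid_generated (B - {b})"
  have "monoid_generated (B - {b}) \<subseteq> monoid_generated (A - {b})"
    using assms by (intro monoid_generated_mono) (auto simp: minimally_generated_by_iff)
  then show False
    using assms b by (auto simp: minimally_generated_by_iff)
qed

text \<open>The summands of a proper decomposition are smaller than \<open>a\<close>, so they do not involve \<open>a\<close>.\<close>

lemma minimal_generator_atom:
  assumes "minimally_generated_by S A" "a \<in> A" "a = x + y" "x \<in> S" "y \<in> S"
  shows "x = 0 \<or> y = 0"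
proof (rule ccontr)
  assume contra: "\<not> (x = 0 \<or> y = 0)"
  have fin: "finite A" and S: "S = monoid_generated A"
    and min: "a \<notin> monoid_generated (A - {a})"
    using assms by (auto simp: minimally_generated_by_iff)
  have small: "z \<in> monoid_generated (A - {a})" if z: "z \<in> S" "vec_size z < vec_size a" for z
  proof -
    obtain u where u: "u \<in> exponents A" "z = factorization_hom A u"
      using z(1) unfolding S monoid_generated_def by blast
    have "a \<notin> supp u"
    proof
      assume "a \<in> supp u"
      then obtain w where "u = unit_exponent a + w"
        by (rule supp_obtain)
      then have "z = a + factorization_hom A w"
        using u fin assms(2) by (simp add: factorization_hom_unit)
      then show False
        using z by simp
    qed
    then have "u \<in> exponents (A - {a})"
      using u(1) by (auto simp: exponents_iff_supp)
    then show ?thesis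
      using u fin factorization_hom_subset[of A "A - {a}" u]
      by (auto simp: monoid_generated_def)
  qed
  have "vec_size x \<noteq> 0" "vec_size y \<noteq> 0"
    using contra by simp_all
  moreover have "vec_size a = vec_size x + vec_size y"
    using assms(3) by simp
  ultimately have "vec_size x < vec_size a" "vec_size y < vec_size a"
    by linarith+
  then have "x \<in> monoid_generated (A - {a})" "y \<in> monoid_generated (A - {a})"
    using assms(4,5) small by blast+
  then show False
    using min assms(3) monoid_generated_add by blast
qed

text \<open>Writing \<open>a\<close> over \<open>B\<close> as \<open>b\<close> plus a rest, the atom
  property forces the rest to vanish, so \<open>a = b\<close>.\<close>

lemma minimal_generating_set_subset:
  assumes "minimally_generated_by S A" "minimally_generated_by S B"
  shows "A \<subseteq> B"
proof
  fix a
  assume a: "a \<in> A"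
  have fin: "finite A" "finite B" and S: "S = monoid_generated A" "S = monoid_generated B"
    using assms by (auto simp: minimally_generated_by_iff)
  have "a \<in> S"
    using a fin S(1) by (auto intro: monoid_generated_base)
  then obtain u where u: "u \<in> exponents B" "a = factorization_hom B u"
    using S(2) by (auto simp: monoid_generated_def)
  have "a \<noteq> 0"
    using a assms minimally_generated_by_zero_notin by blast
  then have "u \<noteq> 0"
    using u by auto
  then obtain b where b: "b \<in> supp u"
    using supp_eq_empty by blast
  then obtain w where w: "u = unit_exponent b + w"
    by (rule supp_obtain)
  have bB: "b \<in> B"
    using b u(1) by (auto simp: exponents_iff_supp)
  have eq: "a = b + factorization_hom B w"
    using u w bB fin by (simp add: factorization_hom_unit)
  have "b \<in> S"
    using bB fin S(2) by (auto intro: monoid_generated_base)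
  moreover have "factorization_hom B w \<in> S"
    using u(1) w unfolding S(2) monoid_generated_def by simp
  ultimately have "b = 0 \<or> factorization_hom B w = 0"
    by (rule minimal_generator_atom[OF assms(1) a eq])
  moreover have "b \<noteq> 0"
    using bB assms minimally_generated_by_zero_notin by blast
  ultimately show "a \<in> B"
    using eq bB by simp
qed

lemma minimal_generating_set_unique:
  "minimally_generated_by S A \<Longrightarrow> minimally_generated_by S B \<Longrightarrow> A = B"
  by (intro antisym minimal_generating_set_subset)

section \<open>Congruences and presentations\<close>

lemma congruence_on_iff:
  "congruence_on A R \<longleftrightarrow> R \<subseteq> exponents A \<times> exponents A \<and> (\<forall>u\<in>exponents A. (u, u) \<in> R) \<and>
     sym R \<and> trans R \<and> (\<forall>(u, v)\<in>R. \<forall>w\<in>exponents A. (u + w, v + w) \<in> R)"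
  by (auto simp: congruence_on_def equiv_def refl_on_def)

lemma congruence_onD:
  assumes "congruence_on A R"
  shows "u \<in> exponents A \<Longrightarrow> (u, u) \<in> R"
    and "(u, v) \<in> R \<Longrightarrow> (v, u) \<in> R"
    and "(u, v) \<in> R \<Longrightarrow> (v, w) \<in> R \<Longrightarrow> (u, w) \<in> R"
    and "(u, v) \<in> R \<Longrightarrow> w \<in> exponents A \<Longrightarrow> (u + w, v + w) \<in> R"
  using assms unfolding congruence_on_iff by (blast dest: symD transD)+

lemma congruence_generated_least:
  "congruence_on A R \<Longrightarrow> \<sigma> \<subseteq> R \<Longrightarrow> congruence_generated A \<sigma> \<subseteq> R"
  by (auto simp: congruence_generated_def)

lemma congruence_generated_base: "\<sigma> \<subseteq> congruence_generated A \<sigma>"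
  by (auto simp: congruence_generated_def)

lemma congruence_on_full: "congruence_on A (exponents A \<times> exponents A)"
  by (auto simp: congruence_on_iff intro!: symI transI)

lemma congruence_on_congruence_generated:
  assumes "\<sigma> \<subseteq> exponents A \<times> exponents A"
  shows "congruence_on A (congruence_generated A \<sigma>)"
  unfolding congruence_on_iff
proof (intro conjI ballI)
  show "congruence_generated A \<sigma> \<subseteq> exponents A \<times> exponents A"
    by (rule congruence_generated_least[OF congruence_on_full assms])
  show "sym (congruence_generated A \<sigma>)"
    by (rule symI) (simp add: congruence_generated_def congruence_on_iff sym_def)
  show "trans (congruence_generated A \<sigma>)"
    unfolding congruence_generated_def trans_def using congruence_onD(3) by blast
qed (auto simp: congruence_generated_def congruence_onD)

text \<open>Working inside the kernel lets the closure conditions on \<open>P\<close> assume that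
  both sides have the same value.\<close>

lemma congruence_on_kernel_subrelation:
  assumes "\<And>x. x \<in> exponents A \<Longrightarrow> P x x"
    and "\<And>x y. (x, y) \<in> kernel_congruence A \<Longrightarrow> P x y \<Longrightarrow> P y x"
    and "\<And>x y z. (x, y) \<in> kernel_congruence A \<Longrightarrow> (y, z) \<in> kernel_congruence A \<Longrightarrow>
           P x y \<Longrightarrow> P y z \<Longrightarrow> P x z"
    and "\<And>x y w. (x, y) \<in> kernel_congruence A \<Longrightarrow> w \<in> exponents A \<Longrightarrow>
           P x y \<Longrightarrow> P (x + w) (y + w)"
  shows "congruence_on A {(x, y) \<in> kernel_congruence A. P x y}"
  unfolding congruence_on_iff
proof (intro conjI)
  show "sym {(x, y) \<in> kernel_congruence A. P x y}"
    by (rule symI) (use assms(2) in \<open>auto simp: kernel_iff\<close>)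
  show "trans {(x, y) \<in> kernel_congruence A. P x y}"
    by (rule transI) (use assms(3) in \<open>auto simp: kernel_iff\<close>)
qed (use assms(1,4) in \<open>auto simp: kernel_iff\<close>)

lemma congruence_on_kernel: "congruence_on A (kernel_congruence A)"
  using congruence_on_kernel_subrelation[of A "\<lambda>_ _. True"] by simp

text \<open>The kernel is the least congruence containing \<open>\<sigma>\<close>, so it lies in
  every congruence that does. This replaces a description of the generated congruence by chains of
  moves.\<close>

lemma presentation_induct [consumes 2, case_names base refl sym trans add]:
  assumes "presentation A \<sigma>" "(x, y) \<in> kernel_congruence A"
    and "\<And>x y. (x, y) \<in> \<sigma> \<Longrightarrow> P x y"
    and "\<And>x. x \<in> exponents A \<Longrightarrow> P x x"
    and "\<And>x y. (x, y) \<in> kernel_congruence A \<Longrightarrow> P x y \<Longrightarrow> P y x"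
    and "\<And>x y z. (x, y) \<in> kernel_congruence A \<Longrightarrow> (y, z) \<in> kernel_congruence A \<Longrightarrow>
           P x y \<Longrightarrow> P y z \<Longrightarrow> P x z"
    and "\<And>x y w. (x, y) \<in> kernel_congruence A \<Longrightarrow> w \<in> exponents A \<Longrightarrow>
           P x y \<Longrightarrow> P (x + w) (y + w)"
  shows "P x y"
proof -
  have "\<sigma> \<subseteq> kernel_congruence A"
    using assms(1) congruence_generated_base[of \<sigma> A] by (auto simp: presentation_def)
  then have "congruence_generated A \<sigma> \<subseteq> {(x, y) \<in> kernel_congruence A. P x y}"
    using assms(3-) by (intro congruence_generated_least congruence_on_kernel_subrelation) auto
  then show ?thesis
    using assms(1,2) by (auto simp: presentation_def)
qed

section \<open>Connectedness of fibres and Betti elements\<close>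

definition linked ::
    "(nat ^ 'r) set \<Rightarrow> nat ^ 'r \<Rightarrow> ((nat ^ 'r \<Rightarrow> nat) \<times> (nat ^ 'r \<Rightarrow> nat)) set" where
  "linked A b =
     {(x, y). x \<in> factorizations A b \<and> y \<in> factorizations A b \<and> supp x \<inter> supp y \<noteq> {}}"

text \<open>A fibre with at most one element counts as connected, so elements outside the semigroup
  never qualify.\<close>

definition disconnected :: "(nat ^ 'r) set \<Rightarrow> nat ^ 'r \<Rightarrow> bool" where
  "disconnected A b \<longleftrightarrow>
     (\<exists>x\<in>factorizations A b. \<exists>y\<in>factorizations A b. (x, y) \<notin> (linked A b)\<^sup>*)"

lemma linked_rtrancl_sym: "(x, y) \<in> (linked A b)\<^sup>* \<Longrightarrow> (y, x) \<in> (linked A b)\<^sup>*"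
proof -
  have "sym (linked A b)"
    by (rule symI) (auto simp: linked_def)
  then show "(x, y) \<in> (linked A b)\<^sup>* \<Longrightarrow> (y, x) \<in> (linked A b)\<^sup>*"
    by (metis sym_rtrancl symD)
qed

lemma linked_rtrancl_factorizations:
  "(x, y) \<in> (linked A b)\<^sup>* \<Longrightarrow> x \<in> factorizations A b \<Longrightarrow> y \<in> factorizations A b"
  by (induction rule: rtrancl_induct) (auto simp: linked_def)

text \<open>Any generator in the support of \<open>w\<close> is common to both sides.\<close>

lemma linked_add:
  assumes "x + w \<in> factorizations A b" "y + w \<in> factorizations A b" "w \<noteq> 0"
  shows "(x + w, y + w) \<in> linked A b"
  using assms by (auto simp: linked_def simp flip: supp_eq_empty)

text \<open>One common generator is removed; it is nonzero, so the value drops. A link is thus a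
  translate of a relation over a smaller element.\<close>

lemma linked_cancel:
  assumes "finite A" "0 \<notin> A" "(x, y) \<in> linked A b"
  obtains x' y' w where "x = x' + w" "y = y' + w" "w \<in> exponents A"
    "(x', y') \<in> kernel_congruence A"
    "vec_size (factorization_hom A x') < vec_size b"
proof -
  obtain a where a: "a \<in> supp x" "a \<in> supp y"
    using assms(3) by (auto simp: linked_def)
  obtain x' where x': "x = unit_exponent a + x'"
    using a(1) by (rule supp_obtain)
  obtain y' where y': "y = unit_exponent a + y'"
    using a(2) by (rule supp_obtain)
  have xy: "x \<in> factorizations A b" "y \<in> factorizations A b"
    using assms(3) by (auto simp: linked_def)
  then have aA: "a \<in> A"
    by (simp add: x' factorizations_iff)
  then have "a \<noteq> 0"
    using assms(2) by auto
  then show ?thesis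
    using xy aA assms(1)
    by (intro that[of x' "unit_exponent a" y'])
      (auto simp: x' y' factorizations_iff kernel_iff factorization_hom_unit add.commute)
qed

lemma linked_rtrancl_subset_congruence:
  assumes "finite A" "0 \<notin> A" "congruence_on A R"
    and "\<And>x y. (x, y) \<in> kernel_congruence A \<Longrightarrow>
           vec_size (factorization_hom A x) < vec_size b \<Longrightarrow> (x, y) \<in> R"
    and "(x, y) \<in> (linked A b)\<^sup>*" "x \<in> factorizations A b"
  shows "(x, y) \<in> R"
  using assms(5)
proof (induction rule: rtrancl_induct)
  case base
  then show ?case
    using assms(3,6) by (simp add: factorizations_iff congruence_onD(1))
next
  case (step y z)
  from assms(1,2) step.hyps(2) have "(y, z) \<in> R"
    by (rule linked_cancel) (use assms(3,4) in \<open>auto intro: congruence_onD(4)\<close>)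
  then show ?case
    using step.IH assms(3) congruence_onD(3) by blast
qed

text \<open>If no pair of \<open>\<sigma>\<close> lies over \<open>b\<close>, then lying in the same
  component is an invariant of the relations of value \<open>b\<close>: nonzero translations are
  links and the zero translation changes nothing.\<close>

lemma disconnected_presentation:
  assumes "presentation A \<sigma>" "disconnected A b"
  obtains u v where "(u, v) \<in> \<sigma>" "factorization_hom A u = b"
proof (rule ccontr)
  assume "\<not> thesis"
  then have no: "factorization_hom A u \<noteq> b" if "(u, v) \<in> \<sigma>" for u v
    using that assms(2) \<open>\<And>v u. \<lbrakk>(u, v) \<in> \<sigma>; factorization_hom A u = b\<rbrakk> \<Longrightarrow> thesis\<close> by blast
  have conn: "factorization_hom A x \<noteq> b \<or> (x, y) \<in> (linked A b)\<^sup>*"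
    if "(x, y) \<in> kernel_congruence A" for x y
    using assms(1) that
  proof (induction x y rule: presentation_induct)
    case (base x y)
    then show ?case
      using no by blast
  next
    case (sym x y)
    then show ?case
      using linked_rtrancl_sym by (auto simp: kernel_iff)
  next
    case (trans x y z)
    then show ?case
      by (auto simp: kernel_iff)
  next
    case (add x y w)
    show ?case
    proof (cases "w = 0")
      case False
      then have "(x + w, y + w) \<in> linked A b" if "factorization_hom A (x + w) = b"
        using add that by (intro linked_add) (simp_all add: factorizations_iff kernel_iff)
      then show ?thesis
        by blast
    qed (use add in simp)
  qed simp
  obtain x y where "x \<in> factorizations A b" "y \<in> factorizations A b" "(x, y) \<notin> (linked A b)\<^sup>*"
    using assms(2) by (auto simp: disconnected_def)
  then show False
    using conn[of x y] by (auto simp: factorizations_iff kernel_iff)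
qed

text \<open>Over a connected fibre the pair is a consequence of relations of smaller value, and
  those are derived without it, so it could be dropped.\<close>

lemma minimal_presentation_disconnected:
  assumes "finite A" "0 \<notin> A" "minimal_presentation A \<sigma>" "(u, v) \<in> \<sigma>"
  shows "disconnected A (factorization_hom A u)"
proof (rule ccontr)
  define b where "b = factorization_hom A u"
  define \<tau> where "\<tau> = \<sigma> - {(u, v)}"
  define R where "R = congruence_generated A \<tau>"
  assume "\<not> disconnected A (factorization_hom A u)"
  then have conn: "(x, y) \<in> (linked A b)\<^sup>*"
    if "x \<in> factorizations A b" "y \<in> factorizations A b" for x y
    using that by (auto simp: disconnected_def b_def)
  have \<sigma>: "presentation A \<sigma>"
    using assms(3) by (simp add: minimal_presentation_def)
  then have exp: "\<tau> \<subseteq> exponents A \<times> exponents A" and ker: "\<sigma> \<subseteq> kernel_congruence A"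
    using congruence_generated_base[of \<sigma> A] by (auto simp: \<tau>_def presentation_def)
  have R: "congruence_on A R"
    unfolding R_def by (rule congruence_on_congruence_generated[OF exp])
  have \<tau>R: "\<tau> \<subseteq> R"
    unfolding R_def by (rule congruence_generated_base)
  \<comment> \<open>Translation never decreases the size, so a relation of size below that of
    \<open>b\<close> has no use for the pair \<open>(u, v)\<close>. The disjunction makes this an
    invariant of the whole kernel.\<close>
  have "vec_size b \<le> vec_size (factorization_hom A x) \<or> (x, y) \<in> R"
    if "(x, y) \<in> kernel_congruence A" for x y
    using \<sigma> that
  proof (induction x y rule: presentation_induct)
    case (base x y)
    then show ?case
      using \<tau>R by (auto simp: \<tau>_def b_def)
  next
    case (trans x y z)
    then show ?case
      using congruence_onD(3)[OF R] by (auto simp: kernel_iff)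
  next
    case (add x y w)
    then show "vec_size b \<le> vec_size (factorization_hom A (x + w)) \<or> (x + w, y + w) \<in> R"
      using congruence_onD(4)[OF R, of x y w] by auto
  qed (use congruence_onD(1,2)[OF R] in \<open>auto simp: kernel_iff\<close>)
  then have small: "(x, y) \<in> R" if "(x, y) \<in> kernel_congruence A"
    "vec_size (factorization_hom A x) < vec_size b" for x y
    using that by (meson leD)
  have uv: "u \<in> factorizations A b" "v \<in> factorizations A b"
    using assms(4) ker by (auto simp: b_def kernel_iff factorizations_iff)
  have "(u, v) \<in> R"
    using linked_rtrancl_subset_congruence[OF assms(1,2) R small conn[OF uv] uv(1)] by blast
  then have "\<sigma> \<subseteq> R"
    using \<tau>R by (auto simp: \<tau>_def)
  then have "kernel_congruence A \<subseteq> R"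
    using \<sigma> congruence_generated_least[OF R, of \<sigma>] by (auto simp: presentation_def)
  moreover have "R \<subseteq> kernel_congruence A"
    unfolding R_def using ker
    by (intro congruence_generated_least congruence_on_kernel) (auto simp: \<tau>_def)
  ultimately have "presentation A \<tau>"
    using exp by (auto simp: presentation_def R_def)
  moreover have "\<tau> \<subset> \<sigma>"
    using assms(4) by (auto simp: \<tau>_def)
  ultimately show False
    using assms(3) by (auto simp: minimal_presentation_def)
qed

text \<open>A minimal presentation is obtained by joining, in every fibre, one connected component to
  each of the others by a single pair.\<close>

lemma minimal_presentation_exists:
  assumes "finite A" "0 \<notin> A"
  obtains \<sigma> where "minimal_presentation A \<sigma>"
proof -
  \<comment> \<open>\<open>SOME\<close> picks the same element for all \<open>x\<close> of one
    component, since they satisfy the same predicate.\<close>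
  define rep where "rep b x = (SOME y. (x, y) \<in> (linked A b)\<^sup>*)" for b x
  define base where "base b = rep b (SOME x. x \<in> factorizations A b)" for b
  define \<sigma> where
    "\<sigma> = {(base b, rep b x) | b x. x \<in> factorizations A b \<and> rep b x \<noteq> base b}"
  have rep: "(x, rep b x) \<in> (linked A b)\<^sup>*" for b x
    unfolding rep_def by (rule someI[of _ x]) simp
  have rep_cong: "rep b x = rep b y" if "(x, y) \<in> (linked A b)\<^sup>*" for b x y
  proof -
    have "(x, z) \<in> (linked A b)\<^sup>* \<longleftrightarrow> (y, z) \<in> (linked A b)\<^sup>*" for z
      using that linked_rtrancl_sym[OF that] by (meson rtrancl_trans)
    then show ?thesis
      by (simp add: rep_def)
  qed
  have rep_fact: "rep b x \<in> factorizations A b" if "x \<in> factorizations A b" for b x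
    using linked_rtrancl_factorizations[OF rep that] .
  have base_fact: "base b \<in> factorizations A b" if "x \<in> factorizations A b" for b x
    unfolding base_def by (rule rep_fact) (rule someI[of "\<lambda>x. x \<in> factorizations A b", OF that])
  have rep_rep: "rep b (rep b x) = rep b x" for b x
    using rep_cong[OF rep] by simp
  have rep_base: "rep b (base b) = base b" for b
    by (simp add: base_def rep_rep)
  have exp: "\<sigma> \<subseteq> exponents A \<times> exponents A" and ker: "\<sigma> \<subseteq> kernel_congruence A"
    using rep_fact base_fact by (fastforce simp: \<sigma>_def factorizations_iff kernel_iff)+
  define R where "R = congruence_generated A \<sigma>"
  have R: "congruence_on A R"
    unfolding R_def by (rule congruence_on_congruence_generated[OF exp])
  have \<sigma>R: "\<sigma> \<subseteq> R"
    unfolding R_def by (rule congruence_generated_base)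
  have "(x, y) \<in> R" if "(x, y) \<in> kernel_congruence A" for x y
    using that
  proof (induction "vec_size (factorization_hom A x)" arbitrary: x y rule: less_induct)
    case less
    define b where "b = factorization_hom A x"
    have xy: "x \<in> factorizations A b" "y \<in> factorizations A b"
      using less.prems by (auto simp: b_def factorizations_iff kernel_iff)
    have link: "(z, z') \<in> R" if "(z, z') \<in> (linked A b)\<^sup>*" "z \<in> factorizations A b" for z z'
      by (rule linked_rtrancl_subset_congruence[OF assms R _ that])
        (use less.hyps in \<open>auto simp: b_def\<close>)
    have "(base b, z) \<in> R" if z: "z \<in> factorizations A b" for z
    proof -
      have "(z, rep b z) \<in> R"
        by (rule link[OF rep z])
      moreover have "(base b, rep b z) \<in> R"
      proof (cases "rep b z = base b")
        case True
        then show ?thesis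
          using base_fact[OF z] congruence_onD(1)[OF R] by (simp add: factorizations_iff)
      next
        case False
        then show ?thesis
          using z \<sigma>R by (auto simp: \<sigma>_def)
      qed
      ultimately show ?thesis
        using congruence_onD(2,3)[OF R] by meson
    qed
    then show ?case
      using xy congruence_onD(2,3)[OF R] by meson
  qed
  then have "kernel_congruence A \<subseteq> R"
    by auto
  moreover have "R \<subseteq> kernel_congruence A"
    unfolding R_def by (intro congruence_generated_least congruence_on_kernel ker)
  ultimately have "presentation A \<sigma>"
    using exp by (auto simp: presentation_def R_def)
  moreover have "\<not> presentation A \<tau>" if \<tau>: "\<tau> \<subset> \<sigma>" for \<tau>
  proof
    assume pres: "presentation A \<tau>"
    obtain b x where bx: "x \<in> factorizations A b" "rep b x \<noteq> base b" "(base b, rep b x) \<notin> \<tau>"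
      using \<tau> by (auto simp: \<sigma>_def)
    \<comment> \<open>Membership in the component of \<open>rep b x\<close> is an invariant of
      \<open>\<tau>\<close>: over \<open>b\<close> its pairs join \<open>base b\<close> to
      representatives of other components, so both ends lie outside. The dropped pair violates the
      invariant.\<close>
    have "factorization_hom A u \<noteq> b \<or> (rep b u = rep b x \<longleftrightarrow> rep b v = rep b x)"
      if "(u, v) \<in> kernel_congruence A" for u v
      using pres that
    proof (induction u v rule: presentation_induct)
      case (base u v)
      then obtain b' y where y: "u = base b'" "v = rep b' y" "y \<in> factorizations A b'"
      proof -
        have "(u, v) \<in> \<sigma>"
          using base \<tau> by blast
        then show ?thesis
          using that unfolding \<sigma>_def by blast
      qed
      have "factorization_hom A u = b'"
        using base_fact[OF y(3)] y(1) by (simp add: factorizations_iff)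
      then show ?case
        using bx base y by (auto simp: rep_base rep_rep)
    next
      case (add u v w)
      show "factorization_hom A (u + w) \<noteq> b \<or>
          (rep b (u + w) = rep b x \<longleftrightarrow> rep b (v + w) = rep b x)"
      proof (cases "w = 0")
        case False
        then have "(u + w, v + w) \<in> linked A b" if "factorization_hom A (u + w) = b"
          using add that by (intro linked_add) (simp_all add: factorizations_iff kernel_iff)
        then show ?thesis
          using rep_cong[OF r_into_rtrancl, of "u + w" "v + w" b] by auto
      qed (use add in simp)
    qed (auto simp: kernel_iff)
    from this[of "base b" "rep b x"] show False
      using bx base_fact[OF bx(1)] rep_fact[OF bx(1)]
      by (auto simp: factorizations_iff kernel_iff rep_base rep_rep)
  qed
  ultimately show ?thesis
    using that by (auto simp: minimal_presentation_def)
qed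

text \<open>From here on presentations can be replaced by fibres. Existence of a minimal
  presentation matters: without one \<open>Betti S\<close> would be empty by default.\<close>

lemma Betti_eq:
  assumes "minimally_generated_by S A"
  shows "Betti S = {b. disconnected A b}"
proof -
  have A: "finite A" "0 \<notin> A"
    using assms minimally_generated_by_zero_notin by (auto simp: minimally_generated_by_def)
  have unique: "B = A" if "minimally_generated_by S B" for B
    by (rule minimal_generating_set_unique[OF that assms])
  show ?thesis
  proof (intro equalityI subsetI)
    fix b
    assume "b \<in> Betti S"
    then obtain B \<sigma> u v where *: "b = factorization_hom B u" "minimally_generated_by S B"
      "minimal_presentation B \<sigma>" "(u, v) \<in> \<sigma>"
      by (auto simp: Betti_def)
    then show "b \<in> {b. disconnected A b}"
      using minimal_presentation_disconnected[OF A] unique[OF *(2)] by auto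
  next
    fix b
    assume "b \<in> {b. disconnected A b}"
    then have b: "disconnected A b"
      by simp
    obtain \<sigma> where \<sigma>: "minimal_presentation A \<sigma>"
      using minimal_presentation_exists[OF A] .
    then have "presentation A \<sigma>"
      by (simp add: minimal_presentation_def)
    then obtain u v where "(u, v) \<in> \<sigma>" "factorization_hom A u = b"
      using b by (rule disconnected_presentation)
    then show "b \<in> Betti S"
      using assms \<sigma> unfolding Betti_def by blast
  qed
qed

text \<open>With \<open>x = u + w\<close> and \<open>y = v + w'\<close>, the path runs through
  \<open>v + w\<close>. The first link shares \<open>w\<close>, nonzero because
  \<open>b \<noteq> d\<close>; the second shares \<open>v\<close>, nonzero because
  \<open>d \<noteq> 0\<close>.\<close>

lemma connected_if_above:
  assumes "x \<in> factorizations A b" "y \<in> factorizations A b"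
    and "u \<in> factorizations A d" "v \<in> factorizations A d"
    and "u \<le> x" "v \<le> y" "b \<noteq> d" "d \<noteq> 0"
  shows "(x, y) \<in> (linked A b)\<^sup>*"
proof -
  obtain w where w: "x = u + w"
    using assms(5) by (rule nat_fun_le_obtain)
  obtain w' where w': "y = v + w'"
    using assms(6) by (rule nat_fun_le_obtain)
  have mid: "v + w \<in> factorizations A b"
    using assms(1,3,4) by (simp add: w factorizations_iff)
  have "w \<noteq> 0"
    using assms(1,3,7) by (auto simp: w factorizations_iff)
  then have 1: "(u + w, v + w) \<in> linked A b"
    using mid assms(1) w by (intro linked_add) auto
  have "v \<noteq> 0"
    using assms(4,8) by (auto simp: factorizations_iff)
  then have "(w + v, w' + v) \<in> linked A b"
    using mid assms(2) w' by (intro linked_add) (auto simp: add.commute)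
  with 1 show ?thesis
    by (auto simp: w w' add.commute)
qed

text \<open>A nonzero factorization is linked to itself, so a path may begin with loops; the first
  step that leaves \<open>x\<close> is wanted.\<close>

lemma rtrancl_distinct_step:
  assumes "(x, y) \<in> R\<^sup>*" "x \<noteq> y"
  obtains z where "(x, z) \<in> R" "x \<noteq> z"
  using assms by (induction rule: converse_rtrancl_induct) metis+

text \<open>The descent step under a single disconnected fibre: some link joins \<open>x\<close> to
  a different factorization, and cancellation keeps the two sides distinct.\<close>

lemma connected_obtain_smaller:
  assumes "finite A" "0 \<notin> A" "\<not> disconnected A b"
    and "x \<in> factorizations A b" "y \<in> factorizations A b" "x \<noteq> y"
  obtains x' z' w where "x = x' + w" "x' \<noteq> z'" "(x', z') \<in> kernel_congruence A"
    "vec_size (factorization_hom A x') < vec_size b"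
proof -
  have "(x, y) \<in> (linked A b)\<^sup>*"
    using assms(3-5) by (auto simp: disconnected_def)
  then obtain z where z: "(x, z) \<in> linked A b" "x \<noteq> z"
    using assms(6) by (rule rtrancl_distinct_step)
  from assms(1,2) z(1) show ?thesis
    by (rule linked_cancel) (rule that, use z(2) in auto)
qed

section \<open>The Graver basis\<close>

lemma minimal_kernel_pairs_iff:
  "(x, y) \<in> minimal_kernel_pairs A \<longleftrightarrow> (x, y) \<in> kernel_congruence A \<and> (x, y) \<noteq> (0, 0) \<and>
    (\<forall>x' y'. (x', y') \<in> kernel_congruence A \<and> (x', y') \<noteq> (0, 0) \<and> x' \<le> x \<and> y' \<le> y \<longrightarrow>
      x' = x \<and> y' = y)"
  unfolding minimal_kernel_pairs_def mem_Collect_eq Ball_def split_paired_All by auto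

text \<open>A minimal pair with equal sides lies above a unit pair, hence is one of the removed
  pairs. Conversely, subtracting an equal pair from a pair of distinct elements leaves a smaller
  pair of distinct elements, so equal pairs do not disturb minimality.\<close>

lemma Graver_basis_iff:
  assumes "finite A"
  shows "(x, y) \<in> Graver_basis A \<longleftrightarrow> (x, y) \<in> kernel_congruence A \<and> x \<noteq> y \<and>
    (\<forall>x' y'. (x', y') \<in> kernel_congruence A \<and> x' \<noteq> y' \<and> x' \<le> x \<and> y' \<le> y \<longrightarrow> x' = x \<and> y' = y)"
    (is "_ \<longleftrightarrow> _ \<and> _ \<and> ?min")
proof
  assume G: "(x, y) \<in> Graver_basis A"
  have M: "(x, y) \<in> minimal_kernel_pairs A"
    and unit: "\<And>a. a \<in> A \<Longrightarrow> (x, y) \<noteq> (unit_exponent a, unit_exponent a)"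
    using G by (auto simp: Graver_basis_def)
  have ker: "(x, y) \<in> kernel_congruence A" and n0: "(x, y) \<noteq> (0, 0)"
    and min: "\<And>x' y'. (x', y') \<in> kernel_congruence A \<Longrightarrow> (x', y') \<noteq> (0, 0) \<Longrightarrow>
      x' \<le> x \<Longrightarrow> y' \<le> y \<Longrightarrow> x' = x \<and> y' = y"
    using M unfolding minimal_kernel_pairs_iff by blast+
  have "x \<noteq> y"
  proof
    assume eq: "x = y"
    then have "supp x \<noteq> {}"
      using n0 by simp
    then obtain a where a: "a \<in> supp x"
      by blast
    have "a \<in> A"
      using a ker by (auto simp: kernel_iff exponents_iff_supp)
    then show False
      using min[of "unit_exponent a" "unit_exponent a"] unit[of a] a eq
      by (auto simp: kernel_iff unit_le_iff)
  qed
  then show "(x, y) \<in> kernel_congruence A \<and> x \<noteq> y \<and> ?min"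
    using ker min by auto
next
  assume H: "(x, y) \<in> kernel_congruence A \<and> x \<noteq> y \<and> ?min"
  have "x' = x \<and> y' = y" if x'y': "(x', y') \<in> kernel_congruence A" "(x', y') \<noteq> (0, 0)"
    "x' \<le> x" "y' \<le> y" for x' y'
  proof (cases "x' = y'")
    case True
    obtain w where w: "x = x' + w"
      using x'y'(3) by (rule nat_fun_le_obtain)
    obtain w' where w': "y = x' + w'"
      using x'y'(4) True nat_fun_le_obtain by blast
    have "(w, w') \<in> kernel_congruence A" "w \<noteq> w'" "w \<le> x" "w' \<le> y"
      using H by (auto simp: kernel_iff w w')
    then have "w = x"
      using H by blast
    then have "x' = 0"
      using w by (simp add: fun_eq_iff)
    then show ?thesis
      using True that by simp
  next
    case False
    then show ?thesis
      using that H by blast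
  qed
  then have "(x, y) \<in> minimal_kernel_pairs A"
    using H unfolding minimal_kernel_pairs_iff by blast
  then show "(x, y) \<in> Graver_basis A"
    using H by (auto simp: Graver_basis_def)
qed

text \<open>A pair that is not minimal dominates another distinct kernel pair of smaller total
  exponent, so the descent ends.\<close>

lemma Graver_basis_below:
  assumes "finite A" "(x, y) \<in> kernel_congruence A" "x \<noteq> y"
  obtains u v where "(u, v) \<in> Graver_basis A" "u \<le> x" "v \<le> y"
proof -
  have "\<exists>u v. (u, v) \<in> Graver_basis A \<and> u \<le> x \<and> v \<le> y"
    using assms(2,3)
  proof (induction "sum x A + sum y A" arbitrary: x y rule: less_induct)
    case less
    show ?case
    proof (cases "(x, y) \<in> Graver_basis A")
      case False
      then obtain x' y' where x'y': "(x', y') \<in> kernel_congruence A" "x' \<noteq> y'" "x' \<le> x" "y' \<le> y"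
        "x' \<noteq> x \<or> y' \<noteq> y"
        using less.prems Graver_basis_iff[OF assms(1)] by blast
      have le: "sum x' A \<le> sum x A" "sum y' A \<le> sum y A"
        using x'y'(3,4) by (auto intro!: sum_mono simp: le_fun_def)
      have lt: "sum z' A < sum z A" if z: "z' \<le> z" "z' \<noteq> z" "z \<in> exponents A" for z z' :: "_ \<Rightarrow> nat"
      proof -
        obtain a where a: "z' a \<noteq> z a"
          using z(2) by blast
        then have "z' a < z a"
          using z(1) by (simp add: le_fun_def order.strict_iff_order)
        moreover from this have "a \<in> A"
          using z(3) by (auto simp: exponents_def)
        ultimately show ?thesis
          using z(1) assms(1) by (intro sum_strict_mono_ex1) (auto simp: le_fun_def)
      qed
      have "sum x' A + sum y' A < sum x A + sum y A"
        using x'y'(5) le lt[OF x'y'(3)] lt[OF x'y'(4)] less.prems(1) by (auto simp: kernel_iff)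
      from less.hyps[OF this x'y'(1,2)] show ?thesis
        using x'y'(3,4) order_trans by blast
    qed auto
  qed
  then show ?thesis
    using that by blast
qed

section \<open>A single disconnected fibre\<close>

text \<open>Condition (a) in terms of fibres: the equivalence says both that the fibre of
  \<open>d\<close> is disconnected and that no other one is.\<close>

locale single_disconnected =
  fixes A :: "(nat ^ 'r) set" and d :: "nat ^ 'r"
  assumes finite: "finite A" and zero_notin: "0 \<notin> A" and d_nonzero: "d \<noteq> 0"
    and disconnected_iff: "disconnected A b \<longleftrightarrow> b = d"
begin

abbreviation Z :: "(nat ^ 'r \<Rightarrow> nat) set" where
  "Z \<equiv> factorizations A d"

lemma Z_nonzero: "u \<in> Z \<Longrightarrow> u \<noteq> 0"
  using d_nonzero by (auto simp: factorizations_iff)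

text \<open>A smallest exception would have a connected fibre with two elements, and cancelling a
  link in it would yield a smaller exception.\<close>

lemma unique_factorization_below:
  assumes "(x, y) \<in> kernel_congruence A" "vec_size (factorization_hom A x) < vec_size d"
  shows "x = y"
  using assms
proof (induction "vec_size (factorization_hom A x)" arbitrary: x y rule: less_induct)
  case less
  define b where "b = factorization_hom A x"
  show ?case
  proof (rule ccontr)
    assume ne: "x \<noteq> y"
    have b: "\<not> disconnected A b"
      using less.prems(2) by (auto simp: disconnected_iff b_def)
    have "x \<in> factorizations A b" "y \<in> factorizations A b"
      using less.prems by (auto simp: b_def factorizations_iff kernel_iff)
    from finite zero_notin b this ne obtain x' z' w where "x' \<noteq> z'" "(x', z') \<in> kernel_congruence A"
      "vec_size (factorization_hom A x') < vec_size b"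
      by (rule connected_obtain_smaller)
    then show False
      using less.hyps[of x' z'] less.prems(2) by (simp add: b_def)
  qed
qed

text \<open>While the value differs from \<open>d\<close> its fibre is connected, so
  \<open>x\<close> can be shrunk to one side of another nontrivial relation; the descent can only
  stop at \<open>d\<close>. The bound below \<open>y\<close> comes from the reversed pair.\<close>

lemma factorization_below:
  assumes "(x, y) \<in> kernel_congruence A" "x \<noteq> y"
  obtains u where "u \<in> Z" "u \<le> x"
proof -
  have "\<exists>u\<in>Z. u \<le> x"
    using assms
  proof (induction "vec_size (factorization_hom A x)" arbitrary: x y rule: less_induct)
    case less
    define b where "b = factorization_hom A x"
    have xy: "x \<in> factorizations A b" "y \<in> factorizations A b"
      using less.prems by (auto simp: b_def factorizations_iff kernel_iff)
    show ?case
    proof (cases "b = d")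
      case False
      then have b: "\<not> disconnected A b"
        by (simp add: disconnected_iff)
      from finite zero_notin b xy less.prems(2) obtain x' z' w
        where "x = x' + w" "x' \<noteq> z'" "(x', z') \<in> kernel_congruence A"
          "vec_size (factorization_hom A x') < vec_size b"
        by (rule connected_obtain_smaller)
      then show ?thesis
        using less.hyps[of x' z'] by (fastforce simp: b_def intro: order_trans)
    qed (use xy in auto)
  qed
  then show ?thesis
    using that by blast
qed

text \<open>A shared generator could be cancelled, leaving two factorizations of a smaller
  element.\<close>

lemma disjoint_supports:
  assumes "u \<in> Z" "v \<in> Z" "u \<noteq> v"
  shows "supp u \<inter> supp v = {}"
proof (rule ccontr)
  assume "supp u \<inter> supp v \<noteq> {}"
  then have "(u, v) \<in> linked A d"
    using assms by (simp add: linked_def)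
  with finite zero_notin obtain u' v' w where "u = u' + w" "v = v' + w"
    "(u', v') \<in> kernel_congruence A" "vec_size (factorization_hom A u') < vec_size d"
    by (rule linked_cancel)
  then show False
    using unique_factorization_below assms(3) by blast
qed

lemma Z_eqI:
  assumes "u \<in> Z" "v \<in> Z" "supp u \<subseteq> supp v"
  shows "u = v"
  using disjoint_supports[OF assms(1,2)] assms(3) Z_nonzero[OF assms(1)] by (metis Int_absorb2 supp_eq_empty)

lemma two_factorizations:
  obtains u v where "u \<in> Z" "v \<in> Z" "u \<noteq> v"
proof -
  have "disconnected A d"
    by (simp add: disconnected_iff)
  then show ?thesis
    using that unfolding disconnected_def by blast
qed

lemma Graver_basis_eq: "Graver_basis A = Z \<times> Z - {(u, u) | u. u \<in> Z}"
proof (intro equalityI subrelI)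
  fix x y
  assume G: "(x, y) \<in> Graver_basis A"
  then have ker: "(x, y) \<in> kernel_congruence A" and ne: "x \<noteq> y"
    and min: "\<And>x' y'. (x', y') \<in> kernel_congruence A \<Longrightarrow> x' \<noteq> y' \<Longrightarrow> x' \<le> x \<Longrightarrow> y' \<le> y \<Longrightarrow>
      x' = x \<and> y' = y"
    using Graver_basis_iff[OF finite] by blast+
  obtain u where u: "u \<in> Z" "u \<le> x"
    using ker ne by (rule factorization_below)
  have "(y, x) \<in> kernel_congruence A"
    using ker by (simp add: kernel_iff)
  then obtain v where v: "v \<in> Z" "v \<le> y"
    using ne[symmetric] by (rule factorization_below)
  \<comment> \<open>A common part could be subtracted from both sides; by minimality this changes
    nothing, so the part would be \<open>0\<close>.\<close>
  have "u \<noteq> v"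
  proof
    assume eq: "u = v"
    obtain w where w: "x = u + w"
      using u(2) by (rule nat_fun_le_obtain)
    obtain w' where w': "y = u + w'"
      using v(2) eq nat_fun_le_obtain by blast
    have "w = x"
      using min[of w w'] ker ne by (auto simp: kernel_iff w w')
    then have "u = 0"
      using w by (simp add: fun_eq_iff)
    then show False
      using u(1) Z_nonzero by blast
  qed
  then have "u = x \<and> v = y"
    using min[of u v] u v by (auto simp: kernel_iff factorizations_iff)
  then show "(x, y) \<in> Z \<times> Z - {(u, u) | u. u \<in> Z}"
    using u v ne by auto
next
  fix u v
  assume "(u, v) \<in> Z \<times> Z - {(u, u) | u. u \<in> Z}"
  then have uv: "u \<in> Z" "v \<in> Z" "u \<noteq> v"
    by auto
  have "x = u \<and> y = v" if xy: "(x, y) \<in> kernel_congruence A" "x \<noteq> y" "x \<le> u" "y \<le> v" for x y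
  proof -
    \<comment> \<open>The common value of \<open>x\<close> and \<open>y\<close> has two
      factorizations, so it is not smaller than \<open>d\<close>; as a summand of \<open>d\<close>
      it leaves no remainder.\<close>
    have eq: "z = w" if z: "z \<le> w" "w \<in> Z" "factorization_hom A z = factorization_hom A x" for z w
    proof -
      obtain t where t: "w = z + t"
        using z(1) by (rule nat_fun_le_obtain)
      have "d = factorization_hom A z + factorization_hom A t" "t \<in> exponents A"
        using z(2) by (auto simp: t factorizations_iff)
      moreover have "vec_size d \<le> vec_size (factorization_hom A z)"
        using unique_factorization_below[OF xy(1)] xy(2) z(3) by fastforce
      ultimately have "factorization_hom A t = 0"
        by simp
      then have "t = 0"
        using factorization_hom_eq_0[OF finite zero_notin \<open>t \<in> exponents A\<close>] by simp
      then show ?thesis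
        by (simp add: t)
    qed
    show ?thesis
      using eq[of x u] eq[of y v] xy uv by (auto simp: kernel_iff)
  qed
  then show "(u, v) \<in> Graver_basis A"
    using uv Graver_basis_iff[OF finite] by (auto simp: kernel_iff factorizations_iff)
qed

text \<open>The factorizations of \<open>d\<close> below \<open>x\<close> and \<open>y\<close> can
  only be \<open>u\<close> and \<open>v\<close>, since their supports are contained in those of
  \<open>u\<close> and \<open>v\<close>. Both are subtracted at once, and \<open>k\<close> counts
  the rounds until nothing is left.\<close>

lemma kernel_pair_multiple:
  assumes "u \<in> Z" "v \<in> Z" "u \<noteq> v"
    and "(x, y) \<in> kernel_congruence A" "supp x \<subseteq> supp u" "supp y \<subseteq> supp v"
  obtains k where "x = (\<lambda>a. k * u a)" "y = (\<lambda>a. k * v a)"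
proof -
  have "\<exists>k. x = (\<lambda>a. k * u a) \<and> y = (\<lambda>a. k * v a)"
    using assms(4-)
  proof (induction "vec_size (factorization_hom A x)" arbitrary: x y rule: less_induct)
    case less
    show ?case
    proof (cases "x = y")
      case True
      then have "supp x \<subseteq> supp u \<inter> supp v"
        using less.prems by auto
      then have "x = 0"
        using disjoint_supports[OF assms(1-3)] by (simp flip: supp_eq_empty)
      then show ?thesis
        using True by (auto simp: fun_eq_iff intro!: exI[of _ 0])
    next
      case False
      have "(y, x) \<in> kernel_congruence A"
        using less.prems(1) by (simp add: kernel_iff)
      then obtain v' where v': "v' \<in> Z" "v' \<le> y"
        using False[symmetric] by (rule factorization_below)
      obtain u' where u': "u' \<in> Z" "u' \<le> x"
        using less.prems(1) False by (rule factorization_below)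
      have "u' = u" "v' = v"
        using u' v' less.prems assms(1,2) supp_mono by (blast intro: Z_eqI)+
      then obtain w w' where w: "x = u + w" and w': "y = v + w'"
        using u'(2) v'(2) nat_fun_le_obtain by metis
      have "(w, w') \<in> kernel_congruence A" "supp w \<subseteq> supp u" "supp w' \<subseteq> supp v"
        "vec_size (factorization_hom A w) < vec_size (factorization_hom A x)"
        using less.prems assms(1,2) d_nonzero by (auto simp: w w' kernel_iff factorizations_iff)
      then obtain k where "w = (\<lambda>a. k * u a)" "w' = (\<lambda>a. k * v a)"
        using less.hyps by blast
      then show ?thesis
        by (auto simp: w w' fun_eq_iff intro!: exI[of _ "Suc k"])
    qed
  qed
  then show ?thesis
    using that by blast
qed

text \<open>Division by a common factor \<open>g\<close> leaves two distinct factorizations of an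
  element whose \<open>g\<close>-fold is \<open>d\<close>. Uniqueness below \<open>d\<close> rules
  out \<open>g > 1\<close>, and \<open>g = 0\<close> would mean \<open>u = 0\<close>.\<close>

lemma Gcd_factorizations:
  assumes "u \<in> Z" "v \<in> Z" "u \<noteq> v"
  shows "Gcd (u ` A \<union> v ` A) = 1"
proof -
  define g where "g = Gcd (u ` A \<union> v ` A)"
  define u0 where "u0 = (\<lambda>a. u a div g)"
  define v0 where "v0 = (\<lambda>a. v a div g)"
  have "g dvd u a" "g dvd v a" for a
    using assms by (cases "a \<in> A"; auto simp: g_def exponents_def factorizations_iff)+
  then have u: "u = (\<lambda>a. g * u0 a)" and v: "v = (\<lambda>a. g * v0 a)"
    by (auto simp: u0_def v0_def)
  have "g \<noteq> 0"
    using u Z_nonzero[OF assms(1)] by (auto simp: fun_eq_iff)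
  have exp: "u0 \<in> exponents A" "v0 \<in> exponents A"
    using assms by (auto simp: u0_def v0_def factorizations_iff exponents_def)
  have d: "d = g *s factorization_hom A u0" "d = g *s factorization_hom A v0"
    using assms u v by (metis factorizations_iff factorization_hom_scale)+
  then have "factorization_hom A u0 = factorization_hom A v0"
    using \<open>g \<noteq> 0\<close> by (auto simp: vec_eq_iff)
  then have "(u0, v0) \<in> kernel_congruence A"
    using exp by (simp add: kernel_iff)
  moreover have "u0 \<noteq> v0"
    using assms(3) u v by auto
  ultimately have "vec_size d \<le> vec_size (factorization_hom A u0)"
    using unique_factorization_below by (meson not_le)
  moreover have "vec_size d = g * vec_size (factorization_hom A u0)"
    by (subst d(1)) simp
  moreover have "vec_size d \<noteq> 0"
    using d_nonzero by simp
  ultimately have "g = 1"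
    using \<open>g \<noteq> 0\<close> by (cases g; cases "g - 1") auto
  then show ?thesis
    by (simp add: g_def)
qed

lemma circuits_eq: "circuits A = Z \<times> Z - {(u, u) | u. u \<in> Z}"
proof (intro equalityI subrelI)
  fix x y
  assume C: "(x, y) \<in> circuits A"
  then have ker: "(x, y) \<in> kernel_congruence A" and n0: "(x, y) \<noteq> (0, 0)"
    and disj: "supp x \<inter> supp y = {}" and gcd: "Gcd (x ` A \<union> y ` A) = 1"
    and min: "\<And>x' y'. (x', y') \<in> disjoint_kernel_pairs A \<Longrightarrow>
      \<not> supp x' \<union> supp y' \<subset> supp x \<union> supp y"
    by (auto simp: circuits_def disjoint_kernel_pairs_def)
  have ne: "x \<noteq> y"
    using n0 disj by auto
  obtain u where u: "u \<in> Z" "u \<le> x"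
    using ker ne by (rule factorization_below)
  have "(y, x) \<in> kernel_congruence A"
    using ker by (simp add: kernel_iff)
  then obtain v where v: "v \<in> Z" "v \<le> y"
    using ne[symmetric] by (rule factorization_below)
  have sub: "supp u \<subseteq> supp x" "supp v \<subseteq> supp y"
    using u v supp_mono by auto
  have "u \<noteq> v"
    using sub disj Z_nonzero[OF u(1)] by (metis Int_greatest subset_empty supp_eq_empty)
  have "(u, v) \<in> disjoint_kernel_pairs A"
    using u v sub disj Z_nonzero[OF u(1)]
    by (auto simp: disjoint_kernel_pairs_def kernel_iff factorizations_iff)
  \<comment> \<open>Minimality makes the unions of supports equal; since \<open>x\<close> and
    \<open>y\<close> have disjoint supports, this holds for each side separately.\<close>
  from min[OF this] have "supp x \<subseteq> supp u" "supp y \<subseteq> supp v"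
    using sub disj by auto
  with u(1) v(1) \<open>u \<noteq> v\<close> ker obtain k where k: "x = (\<lambda>a. k * u a)" "y = (\<lambda>a. k * v a)"
    by (rule kernel_pair_multiple)
  have "k dvd Gcd (x ` A \<union> y ` A)"
    by (rule Gcd_greatest) (auto simp: k)
  then have "k = 1"
    using gcd by simp
  then show "(x, y) \<in> Z \<times> Z - {(u, u) | u. u \<in> Z}"
    using u v k ne by auto
next
  fix u v
  assume "(u, v) \<in> Z \<times> Z - {(u, u) | u. u \<in> Z}"
  then have uv: "u \<in> Z" "v \<in> Z" "u \<noteq> v"
    by auto
  have "(u, v) \<in> disjoint_kernel_pairs A"
    using uv disjoint_supports[OF uv] Z_nonzero
    by (auto simp: disjoint_kernel_pairs_def kernel_iff factorizations_iff)
  moreover have "\<not> supp x \<union> supp y \<subset> supp u \<union> supp v"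
    if xy: "(x, y) \<in> disjoint_kernel_pairs A" for x y
  proof
    assume sub: "supp x \<union> supp y \<subset> supp u \<union> supp v"
    have ker: "(x, y) \<in> kernel_congruence A" "(y, x) \<in> kernel_congruence A"
      and disj: "supp x \<inter> supp y = {}" and ne: "x \<noteq> y"
      using xy by (auto simp: disjoint_kernel_pairs_def kernel_iff)
    obtain s where s: "s \<in> Z" "s \<le> x"
      using ker(1) ne by (rule factorization_below)
    obtain t where t: "t \<in> Z" "t \<le> y"
      using ker(2) ne[symmetric] by (rule factorization_below)
    have st: "supp s \<subseteq> supp x" "supp t \<subseteq> supp y" "supp s \<noteq> {}" "supp t \<noteq> {}"
      using s t supp_mono Z_nonzero by auto
    \<comment> \<open>The support of \<open>w\<close> meets that of \<open>u\<close> or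
      \<open>v\<close>, and distinct factorizations of \<open>d\<close> have disjoint supports. Thus
      \<open>s\<close> and \<open>t\<close> are \<open>u\<close> and \<open>v\<close> in some order,
      and their supports fill the whole union.\<close>
    have "w = u \<or> w = v" if w: "w \<in> Z" "supp w \<subseteq> supp u \<union> supp v" "supp w \<noteq> {}" for w
      using disjoint_supports[OF w(1) uv(1)] disjoint_supports[OF w(1) uv(2)] w by blast
    then have "s = u \<or> s = v" "t = u \<or> t = v"
      using s(1) t(1) st sub by blast+
    moreover have "s \<noteq> t"
      using st disj by blast
    ultimately show False
      using st sub by blast
  qed
  ultimately show "(u, v) \<in> circuits A"
    using Gcd_factorizations[OF uv] by (auto simp: circuits_def)
qed

text \<open>Factorizations of \<open>d\<close> below exponents on \<open>B\<close> are themselves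
  supported in \<open>B\<close>, so the connecting path stays over \<open>B\<close>.\<close>

lemma disconnected_subset:
  assumes "B \<subseteq> A" "disconnected B b"
  shows "b = d"
proof (rule ccontr)
  assume "b \<noteq> d"
  obtain x y where xy: "x \<in> factorizations B b" "y \<in> factorizations B b"
    "(x, y) \<notin> (linked B b)\<^sup>*"
    using assms(2) by (auto simp: disconnected_def)
  then have ne: "x \<noteq> y"
    by auto
  have xyA: "x \<in> factorizations A b" "y \<in> factorizations A b"
    using xy factorizations_subset[OF finite assms(1)] by auto
  then have ker: "(x, y) \<in> kernel_congruence A" "(y, x) \<in> kernel_congruence A"
    by (auto simp: kernel_iff factorizations_iff)
  obtain u where u: "u \<in> Z" "u \<le> x"
    using ker(1) ne by (rule factorization_below)
  obtain v where v: "v \<in> Z" "v \<le> y"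
    using ker(2) ne[symmetric] by (rule factorization_below)
  have "u \<in> exponents B" "v \<in> exponents B"
    using u v xy by (auto simp: factorizations_iff intro: exponents_downward)
  then have "u \<in> factorizations B d" "v \<in> factorizations B d"
    using u v by (auto intro: factorizations_restrict[OF finite assms(1)])
  then show False
    using connected_if_above[OF xy(1,2) _ _ u(2) v(2) \<open>b \<noteq> d\<close> d_nonzero] xy(3) by blast
qed

end

section \<open>Gluings\<close>

lemma int_vec_0 [simp]: "int_vec 0 = 0"
  by (simp add: int_vec_def vec_eq_iff)

lemma int_vec_add [simp]: "int_vec (x + y) = int_vec x + int_vec y"
  by (simp add: int_vec_def vec_eq_iff)

lemma int_vec_smult [simp]: "int_vec (k *s x) = int k *s int_vec x"
  by (simp add: int_vec_def vec_eq_iff)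

lemma int_vec_eq_iff [simp]: "int_vec x = int_vec y \<longleftrightarrow> x = y"
  by (simp add: int_vec_def vec_eq_iff)

lemma group_closure_least:
  assumes "X \<subseteq> group_closure Y"
  shows "group_closure X \<subseteq> group_closure Y"
proof
  fix z
  assume "z \<in> group_closure X"
  then show "z \<in> group_closure Y"
    by induction (use assms in \<open>auto intro: group_closure.diff\<close>)
qed

lemma factorization_hom_closure:
  assumes "finite A"
  shows "int_vec (factorization_hom A x) \<in> subgroup_generated A"
proof -
  have mult: "int_vec (k *s a) \<in> subgroup_generated A" if "a \<in> A" for k a
  proof (induction k)
    case 0
    have "0 *s a = 0"
      by (simp add: vec_eq_iff)
    then show ?case
      by (simp add: subgroup_generated_def)
  next
    case (Suc k)
    have "Suc k *s a = k *s a + a"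
      by (simp add: vec_eq_iff)
    moreover have "int_vec a \<in> subgroup_generated A"
      using that by (auto simp: subgroup_generated_def intro: group_closure.base)
    ultimately show ?case
      using Suc by (simp add: subgroup_generated_def group_closure_add del: int_vec_smult)
  qed
  have "int_vec (\<Sum>a\<in>F. x a *s a) \<in> subgroup_generated A" if "F \<subseteq> A" for F
    using finite_subset[OF that assms] that
  proof (induction F rule: finite_induct)
    case empty
    then show ?case
      by (simp add: subgroup_generated_def)
  next
    case (insert a F)
    then show ?case
      using mult[of a "x a"] by (simp add: subgroup_generated_def group_closure_add del: int_vec_smult)
  qed
  then show ?thesis
    by (simp add: factorization_hom_def)
qed

lemma subgroup_generated_iff:
  assumes "finite A"
  shows "z \<in> subgroup_generated A \<longleftrightarrow> (\<exists>x\<in>exponents A. \<exists>y\<in>exponents A.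
    z = int_vec (factorization_hom A x) - int_vec (factorization_hom A y))"
proof
  assume "z \<in> subgroup_generated A"
  then show "\<exists>x\<in>exponents A. \<exists>y\<in>exponents A.
    z = int_vec (factorization_hom A x) - int_vec (factorization_hom A y)"
    unfolding subgroup_generated_def
  proof induction
    case (base s)
    show ?case
    \<comment> \<open>The base rule of \<open>group_closure\<close> also admits \<open>0\<close>,
      which need not be the image of a generator.\<close>
    proof (cases "s = 0")
      case True
      then show ?thesis
        by (intro bexI[of _ 0]) auto
    next
      case False
      with base obtain a where "a \<in> A" "s = int_vec a"
        by auto
      then have "s = int_vec (factorization_hom A (unit_exponent a)) - int_vec (factorization_hom A 0)"
        using assms by (simp add: factorization_hom_unit)
      moreover have "unit_exponent a \<in> exponents A"
        using \<open>a \<in> A\<close> by simp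
      ultimately show ?thesis
        using zero_in_exponents[of A] by (intro bexI)
    qed
  next
    case (diff s t)
    then obtain x y x' y' where "x \<in> exponents A" "y \<in> exponents A" "x' \<in> exponents A" "y' \<in> exponents A"
      "s = int_vec (factorization_hom A x) - int_vec (factorization_hom A y)"
      "t = int_vec (factorization_hom A x') - int_vec (factorization_hom A y')"
      by blast
    then have "s - t = int_vec (factorization_hom A (x + y')) - int_vec (factorization_hom A (y + x'))"
      "x + y' \<in> exponents A" "y + x' \<in> exponents A"
      by simp_all
    then show ?case
      by (intro bexI)
  qed
next
  assume "\<exists>x\<in>exponents A. \<exists>y\<in>exponents A.
    z = int_vec (factorization_hom A x) - int_vec (factorization_hom A y)"
  then show "z \<in> subgroup_generated A"
    using factorization_hom_closure[OF assms]
    by (auto simp: subgroup_generated_def intro: group_closure.diff)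
qed

lemma subgroup_generated_singletonD:
  assumes "z \<in> subgroup_generated {d}"
  obtains k :: int where "z = k *s int_vec d"
proof -
  obtain x y where "z = int_vec (factorization_hom {d} x) - int_vec (factorization_hom {d} y)"
    using assms subgroup_generated_iff[of "{d}" z] by auto
  then have "z = (int (x d) - int (y d)) *s int_vec d"
    by (simp add: factorization_hom_def vec_eq_iff algebra_simps)
  then show ?thesis
    by (rule that)
qed

lemma subgroup_generated_singleton_subset:
  assumes "finite A" "d \<in> monoid_generated A"
  shows "subgroup_generated {d} \<subseteq> subgroup_generated A"
proof -
  have "int_vec d \<in> subgroup_generated A"
    using assms factorization_hom_closure by (auto simp: monoid_generated_def)
  then show ?thesis
    unfolding subgroup_generated_def by (intro group_closure_least) auto
qed

section \<open>From a single Betti element to a gluing\<close>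

definition restrict_exponent :: "'v set \<Rightarrow> ('v \<Rightarrow> nat) \<Rightarrow> 'v \<Rightarrow> nat" where
  "restrict_exponent B u = (\<lambda>a. if a \<in> B then u a else 0)"

lemma restrict_exponent_in_exponents [simp]: "restrict_exponent B u \<in> exponents B"
  by (simp add: restrict_exponent_def exponents_def)

lemma restrict_exponent_add [simp]:
  "restrict_exponent B (u + v) = restrict_exponent B u + restrict_exponent B v"
  by (auto simp: restrict_exponent_def)

lemma restrict_exponent_id: "u \<in> exponents B \<Longrightarrow> restrict_exponent B u = u"
  by (auto simp: restrict_exponent_def exponents_def)

lemma restrict_exponent_eq_0: "supp u \<inter> B = {} \<Longrightarrow> restrict_exponent B u = 0"
  by (auto simp: restrict_exponent_def supp_def fun_eq_iff)

lemma restrict_exponent_split: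
  "u \<in> exponents (B \<union> C) \<Longrightarrow> B \<inter> C = {} \<Longrightarrow> u = restrict_exponent B u + restrict_exponent C u"
  by (auto simp: restrict_exponent_def exponents_def fun_eq_iff)

context single_disconnected
begin

lemma gluing_exists:
  obtains A1 A2 where "A1 \<subseteq> A" "A2 \<subseteq> A"
    "is_gluing A (monoid_generated A1) (monoid_generated A2) d"
proof -
  obtain u v where uv: "u \<in> Z" "v \<in> Z" "u \<noteq> v"
    by (rule two_factorizations)
  \<comment> \<open>By disjointness \<open>v\<close> avoids \<open>supp u\<close>, so
    \<open>d\<close> has a factorization in each half.\<close>
  define A1 where "A1 = supp u"
  define A2 where "A2 = A - A1"
  have A1: "A1 \<subseteq> A" and A2: "A2 \<subseteq> A" and v: "v \<in> exponents A2"
    using uv disjoint_supports[OF uv] by (auto simp: A1_def A2_def factorizations_iff exponents_iff_supp)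
  have fin: "finite A1" "finite A2"
    using A1 A2 finite finite_subset by auto
  have "A1 \<noteq> {}"
    using Z_nonzero[OF uv(1)] by (simp add: A1_def)
  have "A2 \<noteq> {}"
    using Z_nonzero[OF uv(2)] v by (auto simp: exponents_iff_supp)
  have u: "u \<in> exponents A1"
    by (simp add: A1_def exponents_iff_supp)
  have d1: "d \<in> monoid_generated A1"
    using factorizations_restrict[OF finite A1 uv(1) u] by (auto simp: in_monoid_generated_iff)
  have d2: "d \<in> monoid_generated A2"
    using factorizations_restrict[OF finite A2 uv(2) v] by (auto simp: in_monoid_generated_iff)
  define h where "h x = int_vec (factorization_hom A (restrict_exponent A1 x))" for x
  have h_add: "h (x + y) = h x + h y" for x y
    by (simp add: h_def)
  \<comment> \<open>Every factorization of \<open>d\<close> other than \<open>u\<close> misses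
    \<open>supp u\<close> altogether, so \<open>h\<close> takes only the values \<open>d\<close> and
    \<open>0\<close> on \<open>Z\<close>.\<close>
  have h_Z: "h w \<in> subgroup_generated {d}" if "w \<in> Z" for w
  proof (cases "w = u")
    case True
    then have "h w = int_vec d"
      using u uv(1) by (simp add: h_def restrict_exponent_id factorizations_iff)
    then show ?thesis
      by (auto simp: subgroup_generated_def intro: group_closure.base)
  next
    case False
    then have "h w = 0"
      using disjoint_supports[OF that uv(1)] by (simp add: h_def A1_def restrict_exponent_eq_0)
    then show ?thesis
      by (simp add: subgroup_generated_def)
  qed
  obtain \<sigma> where \<sigma>: "minimal_presentation A \<sigma>"
    using minimal_presentation_exists[OF finite zero_notin] .
  then have pres: "presentation A \<sigma>"
    by (simp add: minimal_presentation_def)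
  have h_ker: "h x - h y \<in> subgroup_generated {d}" if "(x, y) \<in> kernel_congruence A" for x y
    using pres that
  proof (induction x y rule: presentation_induct)
    case (base x y)
    then have "factorization_hom A x = d"
      using minimal_presentation_disconnected[OF finite zero_notin \<sigma>] disconnected_iff by blast
    moreover have "(x, y) \<in> kernel_congruence A"
      using base pres congruence_generated_base[of \<sigma> A] by (auto simp: presentation_def)
    ultimately have "x \<in> Z" "y \<in> Z"
      by (auto simp: factorizations_iff kernel_iff)
    then show ?case
      using h_Z by (auto simp: subgroup_generated_def intro: group_closure.diff)
  next
    case (sym x y)
    then show "h y - h x \<in> subgroup_generated {d}"
      using group_closure_minus_iff[of "h x - h y"] by (simp add: subgroup_generated_def)
  next
    case (trans x y z)
    then show "h x - h z \<in> subgroup_generated {d}"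
      using group_closure_add[of "h x - h y" _ "h y - h z"] by (simp add: subgroup_generated_def)
  next
    case (add x y w)
    then show "h (x + w) - h (y + w) \<in> subgroup_generated {d}"
      by (simp add: h_add)
  qed (simp add: subgroup_generated_def)
  have "subgroup_generated A1 \<inter> subgroup_generated A2 \<subseteq> subgroup_generated {d}"
  proof
    fix z
    assume "z \<in> subgroup_generated A1 \<inter> subgroup_generated A2"
    then obtain x1 y1 x2 y2 where
      e: "x1 \<in> exponents A1" "y1 \<in> exponents A1" "x2 \<in> exponents A2" "y2 \<in> exponents A2"
      and z1: "z = int_vec (factorization_hom A1 x1) - int_vec (factorization_hom A1 y1)"
      and z2: "z = int_vec (factorization_hom A2 x2) - int_vec (factorization_hom A2 y2)"
      unfolding Int_iff subgroup_generated_iff[OF fin(1)] subgroup_generated_iff[OF fin(2)] by blast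
    have eA: "x1 \<in> exponents A" "y1 \<in> exponents A" "x2 \<in> exponents A" "y2 \<in> exponents A"
      using e exponents_mono[OF A1] exponents_mono[OF A2] by auto
    have hom: "factorization_hom A1 x1 = factorization_hom A x1"
      "factorization_hom A1 y1 = factorization_hom A y1"
      "factorization_hom A2 x2 = factorization_hom A x2"
      "factorization_hom A2 y2 = factorization_hom A y2"
      using e factorization_hom_subset[OF finite A1] factorization_hom_subset[OF finite A2] by auto
    \<comment> \<open>Moving negative parts across turns the two expressions for \<open>z\<close>
      into a kernel pair; \<open>h\<close> then forgets the exponents on \<open>A2\<close> and
      returns \<open>z\<close>.\<close>
    have "int_vec (factorization_hom A (x1 + y2)) = int_vec (factorization_hom A (y1 + x2))"
      using z1 z2 unfolding hom by (simp add: algebra_simps)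
    then have "(x1 + y2, y1 + x2) \<in> kernel_congruence A"
      using eA unfolding int_vec_eq_iff kernel_iff by simp
    then have "h (x1 + y2) - h (y1 + x2) \<in> subgroup_generated {d}"
      by (rule h_ker)
    moreover have "h x2 = 0" "h y2 = 0"
    proof -
      have "supp x2 \<inter> A1 = {}" "supp y2 \<inter> A1 = {}"
        using e(3,4) by (auto simp: A2_def exponents_iff_supp)
      then show "h x2 = 0" "h y2 = 0"
        by (simp_all add: h_def restrict_exponent_eq_0)
    qed
    moreover have "h x1 - h y1 = z"
      using e by (simp add: h_def restrict_exponent_id z1 hom)
    ultimately show "z \<in> subgroup_generated {d}"
      by (simp add: h_add)
  qed
  moreover have "subgroup_generated {d} \<subseteq> subgroup_generated A1 \<inter> subgroup_generated A2"
    using subgroup_generated_singleton_subset fin d1 d2 by blast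
  ultimately have "is_gluing A (monoid_generated A1) (monoid_generated A2) d"
    unfolding is_gluing_def using \<open>A1 \<noteq> {}\<close> \<open>A2 \<noteq> {}\<close> A1 d1 d2 d_nonzero
    by (intro exI[of _ A1] exI[of _ A2]) (auto simp: A2_def)
  then show ?thesis
    using A1 A2 that by blast
qed

end

section \<open>From a gluing to a single Betti element\<close>

lemma exponents_disjoint_eq_0:
  "u \<in> exponents B \<Longrightarrow> u \<in> exponents C \<Longrightarrow> B \<inter> C = {} \<Longrightarrow> u = 0"
  by (auto simp: exponents_def fun_eq_iff)

text \<open>A nonzero \<open>w\<close> links the two sides directly. If \<open>w = 0\<close>, both
  are factorizations over \<open>B\<close>, where the fibre is connected.\<close>

lemma connected_swap_summand:
  assumes "finite A" "B \<subseteq> A" "\<not> disconnected B b"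
    and "x \<in> exponents B" "y \<in> exponents B" "w \<in> exponents A"
    and "x + w \<in> factorizations A b" "y + w \<in> factorizations A b"
  shows "(x + w, y + w) \<in> (linked A b)\<^sup>*"
proof (cases "w = 0")
  case True
  then have "x \<in> factorizations B b" "y \<in> factorizations B b"
    using assms by (auto intro: factorizations_restrict)
  then have "(x, y) \<in> (linked B b)\<^sup>*"
    using assms(3) by (auto simp: disconnected_def)
  moreover have "linked B b \<subseteq> linked A b"
    using factorizations_subset[OF assms(1,2)] by (auto simp: linked_def)
  ultimately have "(x, y) \<in> (linked A b)\<^sup>*"
    using rtrancl_mono[of "linked B b" "linked A b"] by blast
  then show ?thesis
    by (simp add: True)
next
  case False
  then show ?thesis
    using linked_add[OF assms(7,8)] by simp
qed

text \<open>Two links suffice for any \<open>n = j + 1\<close>. Exchanging one copy of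
  \<open>u\<close> keeps \<open>z\<close> and \<open>j\<close> copies of \<open>u\<close>, not all
  zero because \<open>b \<noteq> d\<close>; exchanging the other \<open>j\<close> copies keeps
  \<open>z + v\<close>, nonzero because \<open>d \<noteq> 0\<close>.\<close>

lemma connected_swap_multiple:
  assumes "u \<in> factorizations A d" "v \<in> factorizations A d" "d \<noteq> 0" "b \<noteq> d"
    and "z \<in> exponents A" "b = factorization_hom A z + n *s d"
  shows "(z + (\<lambda>a. n * u a), z + (\<lambda>a. n * v a)) \<in> (linked A b)\<^sup>*"
proof (cases n)
  case 0
  then show ?thesis
    by simp
next
  case (Suc j)
  define U where "U = (\<lambda>a. j * u a)"
  define V where "V = (\<lambda>a. j * v a)"
  have nU: "(\<lambda>a. n * u a) = u + U" and nV: "(\<lambda>a. n * v a) = v + V"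
    by (simp_all add: U_def V_def Suc fun_eq_iff)
  have exp: "u \<in> exponents A" "v \<in> exponents A" "U \<in> exponents A" "V \<in> exponents A"
    using assms(1,2) by (auto simp: U_def V_def factorizations_iff exponents_def)
  have hom: "factorization_hom A U = j *s d" "factorization_hom A V = j *s d"
    "factorization_hom A u = d" "factorization_hom A v = d"
    using assms(1,2) by (auto simp: U_def V_def factorization_hom_scale factorizations_iff)
  have b: "b = factorization_hom A z + d + j *s d"
    using assms(6) by (simp add: Suc vec_eq_iff algebra_simps)
  have 1: "u + (z + U) \<in> factorizations A b" "v + (z + U) \<in> factorizations A b"
    "V + (z + v) \<in> factorizations A b" "U + (z + v) \<in> factorizations A b"
    using exp assms(5) by (simp_all add: factorizations_iff hom b ac_simps)
  have "b = factorization_hom A (z + U) + d"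
    by (simp add: b hom ac_simps)
  then have "z + U \<noteq> 0"
    using assms(4) by auto
  from linked_add[OF 1(1,2) this] have 2: "(u + (z + U), v + (z + U)) \<in> linked A b" .
  have "z + v \<noteq> 0"
  proof
    assume "z + v = 0"
    then have "v = 0"
      by (simp add: fun_eq_iff)
    then show False
      using hom(4) assms(3) by simp
  qed
  from linked_add[OF 1(4,3) this] have "(U + (z + v), V + (z + v)) \<in> linked A b" .
  with 2 have "(u + (z + U), V + (z + v)) \<in> (linked A b)\<^sup>*"
    by (simp add: ac_simps)
  then show ?thesis
    by (simp add: nU nV ac_simps)
qed

lemma gluing_disconnected_iff:
  assumes fin: "finite A" and zero: "0 \<notin> A" and A: "A = A1 \<union> A2" "A1 \<inter> A2 = {}"
    and d: "d \<in> monoid_generated A1" "d \<in> monoid_generated A2" "d \<noteq> 0"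
    and grp: "subgroup_generated A1 \<inter> subgroup_generated A2 \<subseteq> subgroup_generated {d}"
    and conn: "\<And>c. c \<noteq> d \<Longrightarrow> \<not> disconnected A1 c" "\<And>c. c \<noteq> d \<Longrightarrow> \<not> disconnected A2 c"
  shows "disconnected A b \<longleftrightarrow> b = d"
proof -
  have sub: "A1 \<subseteq> A" "A2 \<subseteq> A"
    using A by auto
  have fin12: "finite A1" "finite A2"
    using fin A by auto
  let ?\<pi> = "factorization_hom A"
  have cl1: "int_vec (?\<pi> x) \<in> subgroup_generated A1" if "x \<in> exponents A1" for x
    using factorization_hom_closure[OF fin12(1)] factorization_hom_subset[OF fin sub(1) that] by simp
  have cl2: "int_vec (?\<pi> x) \<in> subgroup_generated A2" if "x \<in> exponents A2" for x
    using factorization_hom_closure[OF fin12(2)] factorization_hom_subset[OF fin sub(2) that] by simp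
  have split: "\<exists>x1\<in>exponents A1. \<exists>x2\<in>exponents A2. x = x1 + x2" if "x \<in> exponents A" for x
    using restrict_exponent_split[of x A1 A2] that A restrict_exponent_in_exponents by blast
  have e1: "x \<in> exponents A" if "x \<in> exponents A1" for x
    using that exponents_mono[OF sub(1)] by blast
  have e2: "x \<in> exponents A" if "x \<in> exponents A2" for x
    using that exponents_mono[OF sub(2)] by blast
  obtain u where u: "u \<in> factorizations A d" "u \<in> exponents A1"
    using d(1) factorizations_subset[OF fin sub(1), of d]
    unfolding in_monoid_generated_iff by (metis ex_in_conv factorizations_iff subsetD)
  obtain v where v: "v \<in> factorizations A d" "v \<in> exponents A2"
    using d(2) factorizations_subset[OF fin sub(2), of d]
    unfolding in_monoid_generated_iff by (metis ex_in_conv factorizations_iff subsetD)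
  \<comment> \<open>The difference of the first halves is the opposite difference of the second
    halves, hence lies in both groups.\<close>
  have diff: "\<exists>k. int_vec (?\<pi> x1) - int_vec (?\<pi> y1) = k *s int_vec d"
    if "x1 \<in> exponents A1" "y1 \<in> exponents A1" "x2 \<in> exponents A2" "y2 \<in> exponents A2"
      "?\<pi> (x1 + x2) = ?\<pi> (y1 + y2)" for x1 x2 y1 y2
  proof -
    have "int_vec (?\<pi> (x1 + x2)) = int_vec (?\<pi> (y1 + y2))"
      using that(5) by simp
    then have "int_vec (?\<pi> x1) - int_vec (?\<pi> y1) = int_vec (?\<pi> y2) - int_vec (?\<pi> x2)"
      by (simp add: algebra_simps)
    moreover have "int_vec (?\<pi> x1) - int_vec (?\<pi> y1) \<in> subgroup_generated A1"
      using cl1 that(1,2) unfolding subgroup_generated_def by (intro group_closure.diff)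
    moreover have "int_vec (?\<pi> y2) - int_vec (?\<pi> x2) \<in> subgroup_generated A2"
      using cl2 that(3,4) unfolding subgroup_generated_def by (intro group_closure.diff)
    ultimately have "int_vec (?\<pi> x1) - int_vec (?\<pi> y1) \<in> subgroup_generated {d}"
      using grp by auto
    then show ?thesis
      by (rule subgroup_generated_singletonD) blast
  qed
  have one_side: "w \<in> exponents A1 \<or> w \<in> exponents A2" if w: "w \<in> factorizations A d" for w
  proof -
    obtain w1 w2 where w12: "w1 \<in> exponents A1" "w2 \<in> exponents A2" "w = w1 + w2"
      using split[of w] w by (auto simp: factorizations_iff)
    have dw: "d = ?\<pi> w1 + ?\<pi> w2"
      using w w12(3) by (simp add: factorizations_iff)
    \<comment> \<open>Comparison with \<open>0 + v\<close> makes the value of \<open>w1\<close>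
      itself a multiple of \<open>d\<close>. As a summand of \<open>d\<close> it is \<open>0\<close>
      or \<open>d\<close>, so one half of \<open>w\<close> vanishes.\<close>
    obtain k where "int_vec (?\<pi> w1) - int_vec (?\<pi> 0) = k *s int_vec d"
      using diff[OF w12(1) zero_in_exponents w12(2) v(2)] dw v(1) by (auto simp: factorizations_iff)
    then have k: "int (?\<pi> w1 $ i) = k * int (d $ i)" for i
      by (simp add: int_vec_def vec_eq_iff)
    obtain i where i: "d $ i \<noteq> 0"
      using d(3) by (auto simp: vec_eq_iff)
    have "?\<pi> w1 $ i \<le> d $ i"
      by (simp add: dw)
    then have "k * int (d $ i) \<le> 1 * int (d $ i)" "0 \<le> k * int (d $ i)"
      using k[of i] by linarith+
    then have "k \<le> 1" "0 \<le> k"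
      using i by (simp_all add: zero_le_mult_iff mult_le_cancel_right)
    then consider "k = 0" | "k = 1"
      by linarith
    then show ?thesis
    proof cases
      case 1
      then have "?\<pi> w1 = 0"
        using k by (simp add: vec_eq_iff)
      then show ?thesis
        using factorization_hom_eq_0[OF fin zero e1[OF w12(1)]] w12 by simp
    next
      case 2
      then have "?\<pi> w1 = d"
        using k by (simp add: vec_eq_iff)
      then have "?\<pi> w2 = 0"
        using dw by simp
      then show ?thesis
        using factorization_hom_eq_0[OF fin zero e2[OF w12(2)]] w12 by simp
    qed
  qed
  \<comment> \<open>A link between factorizations of \<open>d\<close> cannot change sides, so
    nothing reachable from \<open>u\<close> leaves \<open>A1\<close>.\<close>
  have "disconnected A d"
  proof (rule ccontr)
    assume "\<not> disconnected A d"
    then have "(u, v) \<in> (linked A d)\<^sup>*"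
      using u v by (auto simp: disconnected_def)
    then have "v \<in> exponents A1"
    proof (induction rule: rtrancl_induct)
      case (step y z)
      have "supp y \<inter> supp z \<noteq> {}" "z \<in> factorizations A d"
        using step.hyps(2) by (auto simp: linked_def)
      then show ?case
        using one_side[of z] step.IH A(2) by (auto simp: exponents_iff_supp)
    qed (use u in simp)
    then have "v = 0"
      using v(2) A(2) by (rule exponents_disjoint_eq_0)
    then show False
      using v(1) d(3) by (auto simp: factorizations_iff)
  qed
  moreover have "\<not> disconnected A b" if b: "b \<noteq> d"
  proof -
    \<comment> \<open>The surplus \<open>n\<close> copies of \<open>d\<close> in the first half are
      written with \<open>u\<close>, turned into copies of \<open>v\<close>, and absorbed by the
      second half: \<open>x1 + x2\<close>, \<open>y1 + U + x2\<close>, \<open>y1 + x2 + V\<close>,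
      \<open>y1 + y2\<close>.\<close>
    have chain: "(x1 + x2, y1 + y2) \<in> (linked A b)\<^sup>*"
      if e: "x1 \<in> exponents A1" "y1 \<in> exponents A1" "x2 \<in> exponents A2" "y2 \<in> exponents A2"
        and x: "x1 + x2 \<in> factorizations A b" and y: "y1 + y2 \<in> factorizations A b"
        and n: "?\<pi> x1 = ?\<pi> y1 + n *s d" for x1 x2 y1 y2 n
    proof -
      define U where "U = (\<lambda>a. n * u a)"
      define V where "V = (\<lambda>a. n * v a)"
      have UV: "U \<in> exponents A1" "V \<in> exponents A2" "?\<pi> U = n *s d" "?\<pi> V = n *s d"
        using u v by (auto simp: U_def V_def exponents_def factorization_hom_scale factorizations_iff)
      have bx: "b = ?\<pi> x1 + ?\<pi> x2" and by': "b = ?\<pi> y1 + ?\<pi> y2"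
        using x y by (auto simp: factorizations_iff)
      have n2: "?\<pi> y2 = ?\<pi> x2 + n *s d"
        using bx by' n by (simp add: vec_eq_iff)
      have 1: "(x1 + x2, (y1 + U) + x2) \<in> (linked A b)\<^sup>*"
        using e(1,2) UV(1,3) e1[OF e(2)] e1[OF UV(1)] e2[OF e(3)] x n bx
        by (intro connected_swap_summand[OF fin sub(1) conn(1)[OF b]])
          (simp_all add: factorizations_iff)
      have 2: "((y1 + x2) + U, (y1 + x2) + V) \<in> (linked A b)\<^sup>*"
        unfolding U_def V_def using e1[OF e(2)] e2[OF e(3)] by' n2
        by (intro connected_swap_multiple[OF u(1) v(1) d(3) b]) (simp_all add: ac_simps)
      have 3: "((x2 + V) + y1, y2 + y1) \<in> (linked A b)\<^sup>*"
        using e(3,4) UV(2,4) e1[OF e(2)] e2[OF e(3)] e2[OF e(4)] e2[OF UV(2)] y n2 by'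
        by (intro connected_swap_summand[OF fin sub(2) conn(2)[OF b]])
          (simp_all add: factorizations_iff ac_simps)
      have "(y1 + U) + x2 = (y1 + x2) + U" "(y1 + x2) + V = (x2 + V) + y1"
        by (simp_all add: ac_simps)
      with 1 2 3 have "(x1 + x2, y2 + y1) \<in> (linked A b)\<^sup>*"
        by (metis rtrancl_trans)
      then show ?thesis
        by (simp add: add.commute)
    qed
    have "(x, y) \<in> (linked A b)\<^sup>*" if x: "x \<in> factorizations A b" and y: "y \<in> factorizations A b" for x y
    proof -
      obtain x1 x2 where x12: "x1 \<in> exponents A1" "x2 \<in> exponents A2" "x = x1 + x2"
        using split[of x] x by (auto simp: factorizations_iff)
      obtain y1 y2 where y12: "y1 \<in> exponents A1" "y2 \<in> exponents A2" "y = y1 + y2"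
        using split[of y] y by (auto simp: factorizations_iff)
      obtain k where "int_vec (?\<pi> x1) - int_vec (?\<pi> y1) = k *s int_vec d"
        using diff[OF x12(1) y12(1) x12(2) y12(2)] x y x12(3) y12(3) by (auto simp: factorizations_iff)
      then have k: "int (?\<pi> x1 $ i) - int (?\<pi> y1 $ i) = k * int (d $ i)" for i
        by (simp add: int_vec_def vec_eq_iff)
      show ?thesis
      \<comment> \<open>The chain moves multiples only from the first half to the second, so a
        negative \<open>k\<close> requires exchanging \<open>x\<close> and \<open>y\<close>.\<close>
      proof (cases "0 \<le> k")
        case True
        then have "int (?\<pi> x1 $ i) = int (?\<pi> y1 $ i + nat k * d $ i)" for i
          using k[of i] by simp
        then have "?\<pi> x1 = ?\<pi> y1 + nat k *s d"
          unfolding of_nat_eq_iff by (simp add: vec_eq_iff)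
        then show ?thesis
          using chain[OF x12(1) y12(1) x12(2) y12(2)] x y x12(3) y12(3) by simp
      next
        case False
        then have "int (?\<pi> y1 $ i) = int (?\<pi> x1 $ i + nat (- k) * d $ i)" for i
          using k[of i] by simp
        then have "?\<pi> y1 = ?\<pi> x1 + nat (- k) *s d"
          unfolding of_nat_eq_iff by (simp add: vec_eq_iff)
        then have "(y, x) \<in> (linked A b)\<^sup>*"
          using chain[OF y12(1) x12(1) y12(2) x12(2)] x y x12(3) y12(3) by simp
        then show ?thesis
          by (rule linked_rtrancl_sym)
      qed
    qed
    then show ?thesis
      by (auto simp: disconnected_def)
  qed
  ultimately show ?thesis
    by blast
qed

section \<open>From circuits and the Graver basis back to the fibres\<close>

text \<open>Used in contrapositive form: a semigroup that is not free has a nontrivial relation. The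
  map \<open>g\<close> renames generators to the numbers below \<open>card A\<close>.\<close>

lemma free_semigroup_if_trivial_kernel:
  assumes "finite A" "\<And>x y. (x, y) \<in> kernel_congruence A \<Longrightarrow> x = y"
  shows "free_semigroup (monoid_generated A)"
proof -
  obtain e where e: "bij_betw e {..<card A} A"
    using ex_bij_betw_nat_finite[OF assms(1)] by (auto simp: atLeast0LessThan)
  define i where "i = inv_into {..<card A} e"
  have i: "i a < card A" "e (i a) = a" if "a \<in> A" for a
    using that bij_betw_inv_into_right[OF e that] bij_betwE[OF bij_betw_inv_into[OF e]]
    by (simp_all add: i_def)
  have e': "e j \<in> A" "i (e j) = j" if "j < card A" for j
    using that bij_betw_inv_into_left[OF e, of j] bij_betwE[OF e] by (simp_all add: i_def)
  define g where "g u = (\<lambda>a. if a \<in> A then u (i a) else 0 :: nat)" for u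
  have g: "bij_betw g (exponents {..<card A}) (exponents A)"
    by (rule bij_betw_byWitness[of _ "\<lambda>w j. if j < card A then w (e j) else 0"])
      (auto simp: g_def exponents_def fun_eq_iff i e')
  have "inj_on (factorization_hom A) (exponents A)"
    using assms(2) by (intro inj_onI) (simp add: kernel_iff)
  then have "bij_betw (factorization_hom A) (exponents A) (monoid_generated A)"
    by (simp add: bij_betw_def monoid_generated_def)
  with g have "bij_betw (factorization_hom A \<circ> g) (exponents {..<card A}) (monoid_generated A)"
    by (rule bij_betw_trans)
  moreover have "g 0 = 0" "g (u + v) = g u + g v" for u v
    by (auto simp: g_def fun_eq_iff)
  ultimately show ?thesis
    unfolding free_semigroup_def
    by (intro exI[of _ "card A"] exI[of _ "factorization_hom A \<circ> g"]) simp
qed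

text \<open>The Graver basis puts every nontrivial relation above one between factorizations of
  \<open>d\<close>, so other fibres are connected. Circuits have disjoint supports, so distinct
  factorizations of \<open>d\<close> are never linked; that there are two of them comes from not
  being free.\<close>

lemma Graver_circuits_disconnected_iff:
  fixes A :: "(nat ^ 'r) set"
  defines "D d \<equiv> factorizations A d \<times> factorizations A d - {(u, u) | u. u \<in> factorizations A d}"
  assumes "finite A" "d \<noteq> 0" "\<not> free_semigroup (monoid_generated A)"
    and circ: "circuits A = D d" and Graver: "D d = Graver_basis A"
  shows "disconnected A b \<longleftrightarrow> b = d"
proof
  assume "disconnected A b"
  then obtain x y where xy: "x \<in> factorizations A b" "y \<in> factorizations A b"
    "(x, y) \<notin> (linked A b)\<^sup>*"
    by (auto simp: disconnected_def)
  then have "(x, y) \<in> kernel_congruence A" "x \<noteq> y"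
    by (auto simp: kernel_iff factorizations_iff)
  with assms(2) obtain u v where uv: "(u, v) \<in> Graver_basis A" "u \<le> x" "v \<le> y"
    by (rule Graver_basis_below)
  then have "u \<in> factorizations A d" "v \<in> factorizations A d"
    unfolding Graver[symmetric] D_def by auto
  then show "b = d"
    using connected_if_above[OF xy(1,2) _ _ uv(2,3) _ assms(3)] xy(3) by blast
next
  assume b: "b = d"
  obtain x y where "(x, y) \<in> kernel_congruence A" "x \<noteq> y"
    using free_semigroup_if_trivial_kernel[OF assms(2)] assms(4) by blast
  with assms(2) obtain u v where "(u, v) \<in> Graver_basis A"
    by (rule Graver_basis_below)
  then have uv: "u \<in> factorizations A d" "v \<in> factorizations A d" "u \<noteq> v"
    unfolding Graver[symmetric] D_def by auto
  have "(u, v) \<notin> (linked A d)\<^sup>*"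
  proof
    assume "(u, v) \<in> (linked A d)\<^sup>*"
    then obtain z where z: "(u, z) \<in> linked A d" "u \<noteq> z"
      using uv(3) by (rule rtrancl_distinct_step)
    then have "(u, z) \<in> circuits A"
      unfolding circ D_def linked_def by auto
    then show False
      using z by (auto simp: circuits_def disjoint_kernel_pairs_def linked_def)
  qed
  then show "disconnected A b"
    using uv b by (auto simp: disconnected_def)
qed

theorem theorem6:
  fixes S A :: "(nat ^ 'r) set" and d :: "nat ^ 'r"
  assumes "affine_semigroup S"
    and "minimally_generated_by S A"
    and "d \<in> S" and "d \<noteq> 0"
  defines "cond_a \<equiv> Betti S = {d}"
    and "cond_b \<equiv>
      circuits A =
        factorizations A d \<times> factorizations A d - {(u, u) | u. u \<in> factorizations A d} \<and>
      factorizations A d \<times> factorizations A d - {(u, u) | u. u \<in> factorizations A d} =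
        Graver_basis A"
    and "cond_c \<equiv> \<exists>S1 S2. is_gluing A S1 S2 d \<and> Betti S1 \<union> Betti S2 \<subseteq> {d}"
  shows "(cond_a \<longleftrightarrow> cond_c) \<and> (cond_a \<longrightarrow> cond_b) \<and> (\<not> free_semigroup S \<longrightarrow> cond_b \<longrightarrow> cond_a)"
proof -
  have A: "finite A" "0 \<notin> A" and S: "S = monoid_generated A"
    using assms(2) minimally_generated_by_zero_notin by (auto simp: minimally_generated_by_def)
  have a_iff: "cond_a \<longleftrightarrow> (\<forall>b. disconnected A b \<longleftrightarrow> b = d)"
    unfolding cond_a_def Betti_eq[OF assms(2)] by auto
  have Betti_sub: "Betti (monoid_generated B) = {b. disconnected B b}" if "B \<subseteq> A" for B
    by (rule Betti_eq[OF minimally_generated_by_subset[OF assms(2) that]])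
  have single: "single_disconnected A d" if cond_a
    using A assms(4) that by unfold_locales (auto simp: a_iff)
  have ab: cond_b if cond_a
    unfolding cond_b_def using single_disconnected.circuits_eq[OF single[OF that]]
      single_disconnected.Graver_basis_eq[OF single[OF that]] by simp
  have ac: cond_c if cond_a
  proof -
    interpret single_disconnected A d
      by (rule single[OF that])
    obtain A1 A2 where "A1 \<subseteq> A" "A2 \<subseteq> A"
      "is_gluing A (monoid_generated A1) (monoid_generated A2) d"
      by (rule gluing_exists)
    moreover from this have "Betti (monoid_generated A1) \<union> Betti (monoid_generated A2) \<subseteq> {d}"
      using disconnected_subset by (auto simp: Betti_sub)
    ultimately show ?thesis
      unfolding cond_c_def by blast
  qed
  have ca: cond_a if c: cond_c
  proof -
    obtain A1 A2 where glue: "A = A1 \<union> A2" "A1 \<inter> A2 = {}"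
      "d \<in> (monoid_generated A1 \<inter> monoid_generated A2) - {0}"
      "subgroup_generated A1 \<inter> subgroup_generated A2 = subgroup_generated {d}"
      and B: "Betti (monoid_generated A1) \<union> Betti (monoid_generated A2) \<subseteq> {d}"
      using c unfolding cond_c_def is_gluing_def by blast
    then have A12: "A = A1 \<union> A2" "A1 \<inter> A2 = {}"
      "d \<in> monoid_generated A1" "d \<in> monoid_generated A2"
      "subgroup_generated A1 \<inter> subgroup_generated A2 \<subseteq> subgroup_generated {d}"
      by simp_all
    have conn: "\<not> disconnected A1 c" "\<not> disconnected A2 c" if "c \<noteq> d" for c
      using B that A12(1) Betti_sub[of A1] Betti_sub[of A2] by auto
    show ?thesis
      unfolding a_iff using gluing_disconnected_iff[OF A A12(1-4) assms(4) A12(5) conn] by blast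
  qed
  have ba: cond_a if "\<not> free_semigroup S" cond_b
    unfolding a_iff using that unfolding S cond_b_def
    by (intro allI Graver_circuits_disconnected_iff[OF A(1) assms(4)]) simp_all
  show ?thesis
    using ab ac ca ba by blast
qed

end
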